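(* Let $f$ be a non-constant meromorphic function on $\mathbb{C}$, $\varepsilon>0$ and $c\in\mathbb{C}$. (1) If $f$ is of finite order, then there exists a set $E=E(f,\varepsilon)$ satisfying $$\limsup_{r\to\infty}\frac{\int_{E\cap[1,r)}dt/t}{\log r}\leq\varepsilon,$$ i.e. of logarithmic density at most $\varepsilon$, such that $$m\left(r,\frac{f(z+c)}{f(z)}\right)=O\left(\frac{\log r}{r}\,T(r,f)\right)$$ for all $r$ outside the set $E$ (as $r\to\infty$). (2) If $\varsigma(f)=\varsigma<1$ and $\varepsilon>0$, then $$m\left(r,\frac{f(z+c)}{f(z)}\right)=o\left(\frac{T(r,f)}{r^{1-\varsigma-\varepsilon}}\right)$$ for all $r$ outside of a set of finite logarithmic measure (as $r\to\infty$).
   Context: $T(r,f)$ and $m(r,f)$ are the standard Nevanlinna characteristic and proximity function. The order of $f$ is $\limsup_{r\to\infty}\frac{\log^+T(r,f)}{\log r}$ and the hyper-order is $\varsigma(f)=\limsup_{r\to\infty}\frac{\log^+\log^+T(r,f)}{\log r}$, with $\log^+x=\max\{0,\log x\}$ (and $\log^+0=0$). A set $E\subset(0,\infty)$ has finite logarithmic measure if $\int_{E\cap[1,\infty)}dt/t<\infty$. In part (2) the exceptional set may depend on $\varepsilon$. *)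

theory Defs
  imports "HOL-Complex_Analysis.Complex_Analysis" "HOL-Library.Landau_Symbols"
begin

text \<open>
  Nevanlinna theory for a meromorphic function \<open>f\<close> on the complex plane. The value that the total
  function \<open>f\<close> takes at a pole is irrelevant below: it affects the integrand of the proximity
  function at finitely many angles only.
\<close>

definition log_plus :: "real \<Rightarrow> real" where
  "log_plus x = (if x > 0 then max 0 (ln x) else 0)"

definition proximity :: "real \<Rightarrow> (complex \<Rightarrow> complex) \<Rightarrow> real" where
  "proximity r f =
     1 / (2 * pi) * (LINT \<theta>:{0..2 * pi}|lborel. log_plus (cmod (f (of_real r * cis \<theta>))))"

text \<open>At a pole, \<open>- zorder f z\<close> is the multiplicity of the pole.\<close>

definition pole_count :: "real \<Rightarrow> (complex \<Rightarrow> complex) \<Rightarrow> real" where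
  "pole_count r f = (\<Sum>z | cmod z \<le> r \<and> is_pole f z. real_of_int (- zorder f z))"

definition integrated_pole_count :: "real \<Rightarrow> (complex \<Rightarrow> complex) \<Rightarrow> real" where
  "integrated_pole_count r f =
     (LINT t:{0<..r}|lborel. (pole_count t f - pole_count 0 f) / t) + pole_count 0 f * ln r"

definition characteristic :: "real \<Rightarrow> (complex \<Rightarrow> complex) \<Rightarrow> real" where
  "characteristic r f = proximity r f + integrated_pole_count r f"

definition growth_order :: "(complex \<Rightarrow> complex) \<Rightarrow> ereal" where
  "growth_order f = Limsup at_top (\<lambda>r. ereal (log_plus (characteristic r f) / ln r))"

definition hyper_order :: "(complex \<Rightarrow> complex) \<Rightarrow> ereal" where
  "hyper_order f = Limsup at_top (\<lambda>r. ereal (log_plus (log_plus (characteristic r f)) / ln r))"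

definition upper_log_density :: "real set \<Rightarrow> ereal" where
  "upper_log_density E =
     Limsup at_top (\<lambda>r. ereal ((LINT t:E \<inter> {1..<r}|lebesgue. 1 / t) / ln r))"

definition finite_log_measure :: "real set \<Rightarrow> bool" where
  "finite_log_measure E \<longleftrightarrow> (\<integral>\<^sup>+t\<in>E \<inter> {1..}. ennreal (1 / t) \<partial>lebesgue) < \<infinity>"

text \<open>The filter \<open>r \<rightarrow> \<infinity>\<close> with \<open>r\<close> restricted to the complement of \<open>E\<close>.\<close>

definition at_top_outside :: "real set \<Rightarrow> real filter" where
  "at_top_outside E = inf at_top (principal (- E))"

end

theory Submission
  imports Defs "HOL-Real_Asymp.Real_Asymp"
begin

text \<open>
  Subtract the Poisson-Jensen formulas of \<open>f\<close> on the disc of radius \<open>R\<close> at \<open>z + c\<close> and at \<open>z\<close>, and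
  average over \<open>|z| = r\<close>. The Poisson kernel moves by at most a multiple of \<open>R / |w - z|\<^sup>2\<close>, whose
  mean over \<open>z\<close> is at most \<open>1 / (R - r)\<close>, and every zero or pole contributes a mean of
  \<open>ln (1 + |c| / |z - b|)\<close>, which is \<open>O(ln r / r)\<close>. Hence, for \<open>r < R < R'\<close>,
  \<open>m(r, f(z + c) / f(z)) = O((1 / (R - r) + ln r / r \<cdot> R' / (R' - R)) \<cdot> T(R', f))\<close>.

  It remains to choose \<open>R'\<close> with \<open>T(R', f) = O(T(r, f))\<close>. As \<open>T\<close> is increasing, it can grow by a
  large factor over three consecutive cells of a grid only rarely: \<open>E\<close> is the union of those cells
  of the grid \<open>2\<^sup>k\<close> in the case of finite order, and \<open>k\<^sup>p\<close> with \<open>p\<close> slightly less than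
  \<open>1 / \<sigma>\<close> in the case of hyper-order \<open>\<sigma> < 1\<close>.

  Circles through zeros or poles are avoided throughout: the countable set of their radii is put into
  \<open>E\<close>, and the grids are scaled by a factor that avoids it.
\<close>

section \<open>Circle means and the Poisson formula\<close>

text \<open>Both gaps \<open>R - r\<close> and \<open>R' - R\<close> enter the estimate, the second
  because bounding the number of zeros and poles in the disc of radius \<open>R\<close> by the
  characteristic needs a larger disc. The gaps must be wide while T(R', f) stays comparable with
  T(r, f). If r lies in cell k of the grid, the choice \<open>R = x (k + 2)\<close>,
  \<open>R' = x (k + 3)\<close> leaves a whole cell in each gap; this is why growth is measured over
  three cells. A cell over whose window T grows by more than the factor A uses up ln A of the growth
  of ln T. On the dyadic grid the gaps are comparable with r, and ln T = O(ln r) leaves room for a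
  density of at most about 3 \<rho> / ln A of such cells, which a large A makes small. On the grid
  k^p the gap at r is about r^(1 - 1/p), so p must exceed 1 / (\<sigma> + \<epsilon>). A cell of
  index k then has logarithmic measure about p / k and ln T is at most about k^(p \<alpha>), where
  \<alpha> is slightly above \<sigma>; the measures of the bad cells are summable as soon as p
  \<alpha> < 1. Both conditions can be met at once, with a power of r to spare that absorbs ln r.
  Whether a cell is bad depends on T alone, so for finite order one set E serves every c.\<close>

definition circle_mean :: "real \<Rightarrow> (complex \<Rightarrow> real) \<Rightarrow> real" where
  "circle_mean r u = 1 / (2 * pi) * (LINT \<theta>:{0..2 * pi}|lborel. u (of_real r * cis \<theta>))"

abbreviation circle_integrable :: "real \<Rightarrow> (complex \<Rightarrow> real) \<Rightarrow> bool" where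
  "circle_integrable r u \<equiv> set_integrable lborel {0..2 * pi} (\<lambda>\<theta>. u (of_real r * cis \<theta>))"

lemma continuous_on_circle:
  fixes u :: "complex \<Rightarrow> 'a::topological_space"
  assumes "continuous_on (sphere 0 \<bar>r\<bar>) u"
  shows "continuous_on A (\<lambda>\<theta>. u (of_real r * cis \<theta>))"
  by (rule continuous_on_compose2[OF assms]) (auto intro!: continuous_intros simp: norm_mult)

lemma circle_integrable_continuous:
  assumes "continuous_on (sphere 0 \<bar>r\<bar>) u"
  shows "circle_integrable r u"
  by (intro borel_integrable_atLeastAtMost' continuous_on_circle assms)

lemma circle_mean_eq_integral:
  assumes "circle_integrable r u"
  shows "circle_mean r u = 1 / (2 * pi) * integral {0..2*pi} (\<lambda>\<theta>. u (of_real r * cis \<theta>))"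
  using set_borel_integral_eq_integral(2)[OF assms] by (simp add: circle_mean_def)

lemma circle_mean_cong:
  assumes "\<And>z. cmod z = \<bar>r\<bar> \<Longrightarrow> u z = v z"
  shows "circle_mean r u = circle_mean r v"
  unfolding circle_mean_def
  by (intro arg_cong2[where f = times] refl set_lebesgue_integral_cong) (auto simp: norm_mult assms)

lemma circle_mean_add:
  assumes "circle_integrable r u" "circle_integrable r v"
  shows "circle_mean r (\<lambda>z. u z + v z) = circle_mean r u + circle_mean r v"
  using set_integral_add(2)[OF assms] by (simp add: circle_mean_def algebra_simps add_divide_distrib)

lemma circle_mean_cmult: "circle_mean r (\<lambda>z. a * u z) = a * circle_mean r u"
  by (simp add: circle_mean_def)

lemma circle_integrable_sum:
  assumes "\<And>i. i \<in> I \<Longrightarrow> circle_integrable r (u i)"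
  shows "circle_integrable r (\<lambda>z. \<Sum>i\<in>I. u i z)"
  using assms unfolding set_integrable_def scaleR_sum_right by (rule Bochner_Integration.integrable_sum)

lemma circle_mean_sum:
  assumes "\<And>i. i \<in> I \<Longrightarrow> circle_integrable r (u i)"
  shows "circle_mean r (\<lambda>z. \<Sum>i\<in>I. u i z) = (\<Sum>i\<in>I. circle_mean r (u i))"
  using assms unfolding circle_mean_def set_lebesgue_integral_def set_integrable_def
  by (simp add: scaleR_sum_right sum_distrib_left sum_divide_distrib)

lemma circle_mean_const [simp]: "circle_mean r (\<lambda>_. a) = a"
  by (simp add: circle_mean_def set_integral_const)

text \<open>Only the dominating function has to be integrable, because an integral that does not exist
  has the value \<open>0\<close>.\<close>

lemma circle_mean_mono:
  assumes "circle_integrable r v" "\<And>z. cmod z = \<bar>r\<bar> \<Longrightarrow> u z \<le> v z" "\<And>z. cmod z = \<bar>r\<bar> \<Longrightarrow> 0 \<le> v z"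
  shows "circle_mean r u \<le> circle_mean r v"
  unfolding circle_mean_def set_lebesgue_integral_def
  using assms(1) unfolding set_integrable_def
  by (intro mult_left_mono integral_mono') (auto simp: norm_mult assms(2,3) indicator_def)

lemma circle_mean_mono':
  assumes "circle_integrable r u" "circle_integrable r v" "\<And>z. cmod z = \<bar>r\<bar> \<Longrightarrow> u z \<le> v z"
  shows "circle_mean r u \<le> circle_mean r v"
  unfolding circle_mean_def using assms
  by (intro mult_left_mono set_integral_mono) (auto simp: norm_mult)

lemma circle_mean_nonneg:
  assumes "\<And>z. cmod z = \<bar>r\<bar> \<Longrightarrow> 0 \<le> u z"
  shows "0 \<le> circle_mean r u"
  unfolding circle_mean_def set_lebesgue_integral_def
  by (intro mult_nonneg_nonneg Bochner_Integration.integral_nonneg) (auto simp: norm_mult assms indicator_def)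

text \<open>The kernel is continuous on a compact product, so Fubini is only needed for integrals of
  continuous functions over a rectangle. The inner means are continuous in the parameter, hence
  integrable.\<close>

lemma circle_mean_swap:
  assumes "continuous_on (sphere 0 \<bar>r\<bar> \<times> sphere 0 \<bar>R\<bar>) (\<lambda>(z, w). K z w)"
  shows "circle_mean r (\<lambda>z. circle_mean R (K z)) = circle_mean R (\<lambda>w. circle_mean r (\<lambda>z. K z w))"
    and "circle_integrable r (\<lambda>z. circle_mean R (K z))"
proof -
  define k where "k \<theta> \<phi> = K (of_real r * cis \<theta>) (of_real R * cis \<phi>)" for \<theta> \<phi>
  have k: "continuous_on A (\<lambda>(\<theta>, \<phi>). k \<theta> \<phi>)" for A
  proof -
    have "continuous_on A (\<lambda>p. (\<lambda>(z, w). K z w) (of_real r * cis (fst p), of_real R * cis (snd p)))"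
      by (rule continuous_on_compose2[OF assms]) (auto intro!: continuous_intros simp: norm_mult)
    then show ?thesis
      by (simp add: k_def case_prod_unfold)
  qed
  have k1: "continuous_on A (k \<theta>)" for A \<theta>
    using continuous_on_compose2[OF k[of UNIV], of A "\<lambda>\<phi>. (\<theta>, \<phi>)"]
    by (simp add: continuous_on_Pair)
  have k2: "continuous_on A (\<lambda>\<theta>. k \<theta> \<phi>)" for A \<phi>
    using continuous_on_compose2[OF k[of UNIV], of A "\<lambda>\<theta>. (\<theta>, \<phi>)"]
    by (simp add: continuous_on_Pair)
  have set1: "set_integrable lborel {0..2*pi} (k \<theta>)" for \<theta>
    by (intro borel_integrable_atLeastAtMost' k1)
  have set2: "set_integrable lborel {0..2*pi} (\<lambda>\<theta>. k \<theta> \<phi>)" for \<phi>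
    by (intro borel_integrable_atLeastAtMost' k2)
  have m1: "circle_mean R (K (of_real r * cis \<theta>)) = 1 / (2*pi) * integral {0..2*pi} (k \<theta>)" for \<theta>
    using set_borel_integral_eq_integral(2)[OF set1[of \<theta>]] by (simp add: circle_mean_def k_def)
  have m2: "circle_mean r (\<lambda>z. K z (of_real R * cis \<phi>)) = 1 / (2*pi) * integral {0..2*pi} (\<lambda>\<theta>. k \<theta> \<phi>)" for \<phi>
    using set_borel_integral_eq_integral(2)[OF set2[of \<phi>]] by (simp add: circle_mean_def k_def)
  have c1: "continuous_on {0..2*pi} (\<lambda>\<theta>. 1 / (2*pi) * integral {0..2*pi} (k \<theta>))"
    using integral_continuous_on_param[of "{0..2*pi}" 0 "2*pi" k] k[of "{0..2*pi} \<times> {0..2*pi}"]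
    by (auto intro!: continuous_intros simp: case_prod_unfold)
  have c2: "continuous_on {0..2*pi} (\<lambda>\<phi>. 1 / (2*pi) * integral {0..2*pi} (\<lambda>\<theta>. k \<theta> \<phi>))"
  proof -
    have "continuous_on ({0..2*pi} \<times> {0..2*pi}) (\<lambda>(\<phi>, \<theta>). k \<theta> \<phi>)"
      using swap_continuous[of 0 0 "2*pi" "2*pi" k] k by (auto simp: cbox_Pair_eq)
    then show ?thesis
      using integral_continuous_on_param[of "{0..2*pi}" 0 "2*pi" "\<lambda>\<phi> \<theta>. k \<theta> \<phi>"]
      by (auto intro!: continuous_intros simp: case_prod_unfold)
  qed
  show int1: "circle_integrable r (\<lambda>z. circle_mean R (K z))"
    unfolding m1 by (intro borel_integrable_atLeastAtMost' c1)
  have int2: "circle_integrable R (\<lambda>w. circle_mean r (\<lambda>z. K z w))"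
    unfolding m2 by (intro borel_integrable_atLeastAtMost' c2)
  show "circle_mean r (\<lambda>z. circle_mean R (K z)) = circle_mean R (\<lambda>w. circle_mean r (\<lambda>z. K z w))"
    unfolding circle_mean_eq_integral[OF int1] circle_mean_eq_integral[OF int2] m1 m2
    using integral_swap_continuous[of 0 0 "2*pi" "2*pi" k] k by simp
qed

section \<open>The Poisson kernel and its mean values\<close>

definition poisson_kernel :: "complex \<Rightarrow> complex \<Rightarrow> real" where
  "poisson_kernel z w = ((cmod w)\<^sup>2 - (cmod z)\<^sup>2) / (cmod (w - z))\<^sup>2"

lemma continuous_on_poisson_kernel:
  assumes "cmod z < r"
  shows "continuous_on (sphere 0 r) (poisson_kernel z)"
proof -
  have "w \<noteq> z" if "cmod w = r" for w using that assms by auto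
  then show ?thesis unfolding poisson_kernel_def by (intro continuous_intros) auto
qed

lemma poisson_kernel_nonneg: "cmod z \<le> cmod w \<Longrightarrow> 0 \<le> poisson_kernel z w"
  unfolding poisson_kernel_def by (intro divide_nonneg_nonneg) (auto intro: power_mono)

lemma poisson_kernel_0 [simp]: "w \<noteq> 0 \<Longrightarrow> poisson_kernel 0 w = 1"
  by (simp add: poisson_kernel_def)

text \<open>The only zero is the reflection of \<open>a\<close> in the circle of radius
  \<open>R\<close>, which lies outside the closed disc.\<close>

lemma reflect_nonzero:
  assumes "cmod a < R" "cmod w \<le> R"
  shows "of_real (R\<^sup>2) - cnj a * w \<noteq> 0"
proof
  assume "of_real (R\<^sup>2) - cnj a * w = 0"
  then have "cmod (of_real (R\<^sup>2)) = cmod (cnj a * w)" by simp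
  then have "R * R = cmod a * cmod w" by (simp add: norm_mult power2_eq_square)
  moreover have "R > 0" using assms(1) norm_ge_zero[of a] by linarith
  ultimately show False
    using mult_left_mono[OF assms(2) norm_ge_zero[of a]] mult_strict_right_mono[OF assms(1), of R] by linarith
qed

text \<open>Cauchy's formula for \<open>h w (R\<^sup>2 - |z|\<^sup>2) / (R\<^sup>2 - \<open>cnj z\<close> w)\<close>, which agrees with \<open>h\<close> at \<open>z\<close>.\<close>

lemma poisson_formula_complex:
  assumes h: "h holomorphic_on cball 0 R" and z: "cmod z < R"
  shows "((\<lambda>\<theta>. of_real (poisson_kernel z (of_real R * cis \<theta>)) * h (of_real R * cis \<theta>))
           has_integral 2 * of_real pi * h z) {0..2*pi}"
proof -
  have R: "R > 0" using z norm_ge_zero[of z] by linarith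
  define F where "F w = h w * (of_real (R\<^sup>2) - z * cnj z) / (of_real (R\<^sup>2) - cnj z * w)" for w
  note nz = reflect_nonzero[OF z]
  have F: "F holomorphic_on cball 0 R"
    unfolding F_def using h nz by (auto intro!: holomorphic_intros)
  have Fz: "F z = h z"
    unfolding F_def using nz[of z] z by (simp add: mult.commute[of z])
  have "((\<lambda>w. F w / (w - z)) has_contour_integral 2 * of_real pi * \<i> * F z) (circlepath 0 R)"
    by (rule Cauchy_integral_circlepath_simple[OF F]) (use z in auto)
  then have "((\<lambda>\<theta>. F (of_real R * cis \<theta>) / (of_real R * cis \<theta> - z) * of_real R * \<i> * cis \<theta>)
               has_integral 2 * of_real pi * \<i> * h z) {0..2*pi}"
    unfolding circlepath_def by (subst (asm) has_contour_integral_part_circlepath_iff) (auto simp: Fz)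
  \<comment> \<open>The factor -i cancels the i in dw = i w d\<theta>.\<close>
  then have "((\<lambda>\<theta>. -\<i> * (F (of_real R * cis \<theta>) / (of_real R * cis \<theta> - z) * of_real R * \<i> * cis \<theta>))
               has_integral -\<i> * (2 * of_real pi * \<i> * h z)) {0..2*pi}"
    by (rule has_integral_mult_right)
  also have "-\<i> * (2 * of_real pi * \<i> * h z) = 2 * of_real pi * h z"
    by (simp add: algebra_simps)
  also have "(\<lambda>\<theta>. -\<i> * (F (of_real R * cis \<theta>) / (of_real R * cis \<theta> - z) * of_real R * \<i> * cis \<theta>)) =
             (\<lambda>\<theta>. of_real (poisson_kernel z (of_real R * cis \<theta>)) * h (of_real R * cis \<theta>))"
  proof
    fix \<theta> :: real
    define w where "w = of_real R * cis \<theta>"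
    have cw: "cmod w = R" using R by (simp add: w_def norm_mult)
    \<comment> \<open>On the circle the denominator R^2 - (cnj z) w factors as w (cnj w - cnj z);
      together with 1 / (w - z) from Cauchy's formula this yields |w - z|^2.\<close>
    have RR: "of_real (R\<^sup>2) = w * cnj w"
      using complex_norm_square[of w] by (simp add: cw)
    have w0: "w \<noteq> 0" using cw R norm_zero by (metis less_irrefl)
    have wz: "w \<noteq> z" using cw z by (metis less_irrefl)
    have wz': "cnj w - cnj z \<noteq> 0" using wz by (metis complex_cnj_cancel_iff right_minus_eq)
    have "of_real (poisson_kernel z w) = (w * cnj w - z * cnj z) / ((w - z) * (cnj w - cnj z))"
      unfolding poisson_kernel_def of_real_divide of_real_diff complex_norm_square by simp
    moreover have "F w = h w * (w * cnj w - z * cnj z) / (w * (cnj w - cnj z))"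
      unfolding F_def RR by (simp add: algebra_simps)
    moreover have "-\<i> * (X * of_real R * \<i> * cis \<theta>) = X * w" for X
      by (simp add: w_def algebra_simps)
    moreover have "h w * (w * cnj w - z * cnj z) / (w * (cnj w - cnj z)) / (w - z) * w =
        (w * cnj w - z * cnj z) / ((w - z) * (cnj w - cnj z)) * h w"
      using w0 wz wz' by (simp add: mult.commute)
    ultimately have "-\<i> * (F w / (w - z) * of_real R * \<i> * cis \<theta>) = of_real (poisson_kernel z w) * h w"
      by (simp only:)
    then show "-\<i> * (F (of_real R * cis \<theta>) / (of_real R * cis \<theta> - z) * of_real R * \<i> * cis \<theta>) =
        of_real (poisson_kernel z (of_real R * cis \<theta>)) * h (of_real R * cis \<theta>)"
      by (simp add: w_def)
  qed
  finally show ?thesis .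
qed

text \<open>A holomorphic function without zeros on a disc has a holomorphic logarithm, and ln |g|
  is its real part. The larger disc makes the logarithm holomorphic on the closed disc of radius
  \<open>R\<close>.\<close>

lemma poisson_formula_ln:
  assumes g: "g holomorphic_on ball 0 R'" "\<And>w. cmod w < R' \<Longrightarrow> g w \<noteq> 0" and R: "R < R'"
    and z: "cmod z < R"
  shows "circle_mean R (\<lambda>w. poisson_kernel z w * ln (cmod (g w))) = ln (cmod (g z))"
proof -
  have "0 \<in> ball (0::complex) R'" using z R norm_ge_zero[of z] by (simp del: norm_ge_zero)
  from holomorphic_logarithm_exists[OF convex_ball open_ball g(1) _ this] g(2)
  obtain h where h: "h holomorphic_on ball 0 R'" "\<And>w. w \<in> ball 0 R' \<Longrightarrow> exp (h w) = g w"
    by (metis dist_0_norm mem_ball)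
  have R0: "R > 0" using z norm_ge_zero[of z] by linarith
  have ln: "ln (cmod (g w)) = Re (h w)" if "cmod w \<le> R" for w
    using h(2)[of w] that R by (metis dist_0_norm ln_exp mem_ball norm_exp_eq_Re order_le_less_trans)
  have hR: "h holomorphic_on cball 0 R"
    by (rule holomorphic_on_subset[OF h(1)]) (use R in auto)
  from has_integral_Re[OF poisson_formula_complex[OF hR z]]
  have "((\<lambda>\<theta>. poisson_kernel z (of_real R * cis \<theta>) * Re (h (of_real R * cis \<theta>)))
           has_integral 2 * pi * Re (h z)) {0..2*pi}"
    by simp
  moreover have "continuous_on (sphere 0 \<bar>R\<bar>) (\<lambda>w. poisson_kernel z w * Re (h w))"
    using R0 z holomorphic_on_imp_continuous_on[OF holomorphic_on_subset[OF hR, of "sphere 0 R"]]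
    by (auto intro!: continuous_intros continuous_on_poisson_kernel)
  ultimately have "circle_mean R (\<lambda>w. poisson_kernel z w * Re (h w)) = Re (h z)"
    by (subst circle_mean_eq_integral) (auto intro!: circle_integrable_continuous dest: integral_unique)
  moreover have "circle_mean R (\<lambda>w. poisson_kernel z w * ln (cmod (g w))) =
        circle_mean R (\<lambda>w. poisson_kernel z w * Re (h w))"
    by (rule circle_mean_cong) (use R0 ln in auto)
  ultimately show ?thesis using ln[of z] z by simp
qed

lemma circle_mean_ln_holomorphic:
  assumes "g holomorphic_on ball 0 R'" "\<And>w. cmod w < R' \<Longrightarrow> g w \<noteq> 0" and "0 < R" "R < R'"
  shows "circle_mean R (\<lambda>w. ln (cmod (g w))) = ln (cmod (g 0))"
proof -
  have "circle_mean R (\<lambda>w. ln (cmod (g w))) = circle_mean R (\<lambda>w. poisson_kernel 0 w * ln (cmod (g w)))"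
    by (rule circle_mean_cong) (use assms(3) in auto)
  then show ?thesis
    using poisson_formula_ln[OF assms(1,2,4), of 0] assms(3) by simp
qed

lemma circle_mean_poisson_kernel:
  assumes "cmod z < R"
  shows "circle_mean R (poisson_kernel z) = 1"
proof -
  \<comment> \<open>A constant function whose logarithm is 1 leaves the bare kernel.\<close>
  have "circle_mean R (\<lambda>w. poisson_kernel z w * ln (cmod (of_real (exp 1)))) = ln (cmod (of_real (exp 1)))"
    by (rule poisson_formula_ln[of "\<lambda>_. of_real (exp 1)" "R + 1"]) (use assms in auto)
  then show ?thesis by simp
qed

text \<open>Exchanging the angles of \<open>z\<close> and \<open>w\<close> preserves \<open>|w - z|\<close>, so this mean over the inner circle is
  a mean of the Poisson kernel over the outer one.\<close>

lemma circle_mean_inverse_dist_square: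
  assumes r: "0 \<le> r" "r < R" and w: "cmod w = R"
  shows "circle_mean r (\<lambda>z. 1 / (cmod (w - z))\<^sup>2) = 1 / (R\<^sup>2 - r\<^sup>2)"
proof -
  obtain \<phi> where w_eq: "w = of_real R * cis \<phi>"
    using w by (metis rcis_cmod_Arg rcis_def)
  define z' where "z' = of_real r * cis \<phi>"
  have R: "R > 0" using r by simp
  have d: "cmod (of_real R * cis \<theta> - z') = cmod (w - of_real r * cis \<theta>)" for \<theta>
  proof -
    have "w - of_real r * cis \<theta> = cis \<phi> * cis \<theta> * cnj (of_real R * cis \<theta> - z')"
      by (simp add: w_eq z'_def algebra_simps cis_cnj flip: cis_divide cis_inverse)
    then have "cmod (w - of_real r * cis \<theta>) = cmod (cnj (of_real R * cis \<theta> - z'))"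
      by (simp only: norm_mult norm_cis mult_1)
    then show ?thesis by (simp only: complex_mod_cnj)
  qed
  have pos: "R\<^sup>2 - r\<^sup>2 > 0" using r by (simp add: power_strict_mono)
  have "1 = circle_mean R (poisson_kernel z')"
    by (rule circle_mean_poisson_kernel[symmetric]) (use r in \<open>simp add: z'_def norm_mult\<close>)
  also have "\<dots> = circle_mean r (\<lambda>z. (R\<^sup>2 - r\<^sup>2) * (1 / (cmod (w - z))\<^sup>2))"
    unfolding circle_mean_def poisson_kernel_def d using r R by (simp add: norm_mult z'_def)
  also have "\<dots> = (R\<^sup>2 - r\<^sup>2) * circle_mean r (\<lambda>z. 1 / (cmod (w - z))\<^sup>2)"
    by (rule circle_mean_cmult)
  finally show ?thesis using pos by (simp add: field_simps)
qed

section \<open>Means of logarithmic kernels\<close>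

text \<open>On the circle R^2 = w (cnj w). Hence the reflected factor can stand in for |w - a| on
  the boundary while having no zero inside.\<close>

lemma cmod_reflect:
  assumes "cmod w = R"
  shows "cmod (of_real (R\<^sup>2) - cnj a * w) = R * cmod (w - a)"
proof -
  have "of_real (R\<^sup>2) - cnj a * w = w * cnj (w - a)"
    using complex_norm_square[of w] assms by (simp add: algebra_simps)
  then show ?thesis
    using assms by (simp only: norm_mult complex_mod_cnj)
qed

text \<open>Green's function of the disc of radius \<open>R\<close> with pole \<open>a\<close>,
  split into logarithms that can be averaged and compared one by one.\<close>

definition green :: "real \<Rightarrow> complex \<Rightarrow> complex \<Rightarrow> real" where
  "green R z a = ln (cmod (of_real (R\<^sup>2) - cnj a * z)) - ln R - ln (cmod (z - a))"

text \<open>The function ln |w - a| is singular inside the disc, so the Poisson formula does not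
  apply to it. On the circle it agrees with the logarithm of the reflected factor, to which the
  formula does apply.\<close>

lemma poisson_ln_dist:
  assumes a: "cmod a < R" and z: "cmod z < R"
  shows "circle_mean R (\<lambda>w. poisson_kernel z w * ln (cmod (w - a))) =
           ln (cmod (of_real (R\<^sup>2) - cnj a * z)) - ln R"
proof -
  have R: "R > 0" using z norm_ge_zero[of z] by linarith
  \<comment> \<open>The reflected factor vanishes at modulus R^2 / |a| only; for a = 0 it is
    constant and any larger radius will do.\<close>
  define R' where "R' = (if a = 0 then R + 1 else R\<^sup>2 / cmod a)"
  have R': "R < R'" using a R by (auto simp: R'_def field_simps power2_eq_square)
  define g where "g w = (of_real (R\<^sup>2) - cnj a * w) / of_real R" for w
  have nz: "g w \<noteq> 0" if "cmod w < R'" for w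
  proof
    assume "g w = 0"
    then have "cmod (of_real (R\<^sup>2)) = cmod (cnj a * w)" using R by (simp add: g_def)
    then have "R\<^sup>2 = cmod a * cmod w" by (simp add: norm_mult norm_power)
    moreover have "a \<noteq> 0" using calculation R by auto
    ultimately show False using that by (auto simp: R'_def field_simps)
  qed
  have "circle_mean R (\<lambda>w. poisson_kernel z w * ln (cmod (w - a))) =
        circle_mean R (\<lambda>w. poisson_kernel z w * ln (cmod (g w)))"
  proof (rule circle_mean_cong)
    fix w assume "cmod w = \<bar>R\<bar>"
    then have "cmod (g w) = cmod (w - a)"
      using R cmod_reflect[of w R a] by (simp add: g_def norm_divide)
    then show "poisson_kernel z w * ln (cmod (w - a)) = poisson_kernel z w * ln (cmod (g w))" by simp
  qed
  also have "\<dots> = ln (cmod (g z))"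
    by (rule poisson_formula_ln[OF _ nz R' z]) (auto simp: g_def R less_imp_neq[symmetric] intro!: holomorphic_intros)
  also have "\<dots> = ln (cmod (of_real (R\<^sup>2) - cnj a * z)) - ln R"
    using R reflect_nonzero[OF a, of z] z by (simp add: g_def norm_divide ln_div)
  finally show ?thesis .
qed

text \<open>For b inside, this is \<open>poisson_ln_dist\<close> at the centre; for b outside, ln |z
  - b| is harmonic on the disc of radius |b|.\<close>

lemma circle_mean_ln_dist:
  assumes s: "0 < s" and b: "cmod b \<noteq> s"
  shows "circle_mean s (\<lambda>z. ln (cmod (z - b))) = ln (max s (cmod b))"
proof (cases "cmod b < s")
  case True
  have "circle_mean s (\<lambda>z. ln (cmod (z - b))) = circle_mean s (\<lambda>z. poisson_kernel 0 z * ln (cmod (z - b)))"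
    by (rule circle_mean_cong) (use s in auto)
  also have "\<dots> = ln (s\<^sup>2) - ln s"
    using poisson_ln_dist[OF True, of 0] s by (simp del: of_real_power)
  finally show ?thesis using s True by (simp add: ln_realpow)
next
  case False
  then have "circle_mean s (\<lambda>z. ln (cmod (z - b))) = ln (cmod (0 - b))"
    using s b by (intro circle_mean_ln_holomorphic[of _ "cmod b"]) (auto intro!: holomorphic_intros)
  then show ?thesis using False by simp
qed

text \<open>The sign comes from the identity |R^2 - (cnj a) z|^2 - R^2 |z - a|^2 = (R^2 - |a|^2)
  (R^2 - |z|^2).\<close>

lemma green_nonneg:
  assumes a: "cmod a < R" and z: "cmod z < R" "z \<noteq> a"
  shows "0 \<le> green R z a"
proof -
  have R: "R > 0" using z norm_ge_zero[of z] by linarith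
  have "of_real ((cmod (of_real (R\<^sup>2) - cnj a * z))\<^sup>2 - (R * cmod (z - a))\<^sup>2) =
        (of_real ((R\<^sup>2 - (cmod a)\<^sup>2) * (R\<^sup>2 - (cmod z)\<^sup>2)) :: complex)"
    unfolding of_real_diff of_real_mult power_mult_distrib complex_norm_square
    by (simp add: algebra_simps complex_norm_square power2_eq_square)
  then have eq: "(cmod (of_real (R\<^sup>2) - cnj a * z))\<^sup>2 - (R * cmod (z - a))\<^sup>2 =
        (R\<^sup>2 - (cmod a)\<^sup>2) * (R\<^sup>2 - (cmod z)\<^sup>2)"
    by (simp only: of_real_eq_iff)
  have "0 \<le> (R\<^sup>2 - (cmod a)\<^sup>2) * (R\<^sup>2 - (cmod z)\<^sup>2)"
    using a z by (intro mult_nonneg_nonneg) (auto intro: power_mono)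
  then have "(R * cmod (z - a))\<^sup>2 \<le> (cmod (of_real (R\<^sup>2) - cnj a * z))\<^sup>2"
    using eq by linarith
  then have "R * cmod (z - a) \<le> cmod (of_real (R\<^sup>2) - cnj a * z)"
    by (rule power2_le_imp_le) simp
  moreover have "R * cmod (z - a) > 0" using R z by simp
  ultimately have "ln (R * cmod (z - a)) \<le> ln (cmod (of_real (R\<^sup>2) - cnj a * z))"
    by (intro ln_mono) auto
  then show ?thesis
    using R z by (simp add: green_def ln_mult)
qed

lemma continuous_on_green:
  assumes "\<And>z. z \<in> S \<Longrightarrow> cmod z \<le> R \<and> z \<noteq> a" "cmod a < R"
  shows "continuous_on S (\<lambda>z. green R z a)"
proof -
  have "of_real (R\<^sup>2) - cnj a * z \<noteq> 0" if "z \<in> S" for z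
    using assms that reflect_nonzero by blast
  then show ?thesis
    unfolding green_def using assms by (intro continuous_intros) auto
qed

text \<open>The reflected factor has no zero in the disc, so its logarithm averages to its value ln
  (r^2) at the centre; the pole term is \<open>circle_mean_ln_dist\<close>. The exact value is what
  makes the pole terms match in \<open>characteristic_mono\<close>.\<close>

lemma circle_mean_green:
  assumes s: "0 < s" "s < r" and b: "cmod b < r" "cmod b \<noteq> s"
  shows "circle_mean s (\<lambda>z. green r z b) = ln r - ln (max s (cmod b))"
proof -
  have r: "r > 0" using s by simp
  define R' where "R' = (if b = 0 then r else r\<^sup>2 / cmod b)"
  have "r * cmod b < r * r" using b r by (intro mult_strict_left_mono) auto
  then have R': "r \<le> R'" using r by (auto simp: R'_def field_simps power2_eq_square)
  have nz: "of_real (r\<^sup>2) - cnj b * w \<noteq> 0" if "cmod w < r" for w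
    using reflect_nonzero[OF b(1)] that by simp
  have 1: "circle_mean s (\<lambda>z. ln (cmod (of_real (r\<^sup>2) - cnj b * z))) = ln (cmod (of_real (r\<^sup>2) - cnj b * 0))"
    by (rule circle_mean_ln_holomorphic[OF _ nz s]) (auto intro!: holomorphic_intros)
  have nb: "z \<noteq> b" if "cmod z = s" for z using that b by auto
  have i1: "circle_integrable s (\<lambda>z. ln (cmod (of_real (r\<^sup>2) - cnj b * z)) + - ln r)"
    by (rule circle_integrable_continuous) (use s nz in \<open>auto intro!: continuous_intros\<close>)
  have i2: "circle_integrable s (\<lambda>z. - ln (cmod (z - b)))"
    by (rule circle_integrable_continuous) (use s nb in \<open>auto intro!: continuous_intros\<close>)
  have i3: "circle_integrable s (\<lambda>z. ln (cmod (of_real (r\<^sup>2) - cnj b * z)))"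
    by (rule circle_integrable_continuous) (use s nz in \<open>auto intro!: continuous_intros\<close>)
  have i4: "circle_integrable s (\<lambda>z. - ln r)"
    by (rule circle_integrable_continuous) auto
  have "circle_mean s (\<lambda>z. green r z b) =
        circle_mean s (\<lambda>z. (ln (cmod (of_real (r\<^sup>2) - cnj b * z)) + - ln r) + - ln (cmod (z - b)))"
    by (rule circle_mean_cong) (simp add: green_def)
  also have "\<dots> = circle_mean s (\<lambda>z. ln (cmod (of_real (r\<^sup>2) - cnj b * z))) + - ln r
                  + - circle_mean s (\<lambda>z. ln (cmod (z - b)))"
    using circle_mean_add[OF i1 i2] circle_mean_add[OF i3 i4] circle_mean_cmult[of s "-1" "\<lambda>z. ln (cmod (z - b))"]
    by simp
  also have "\<dots> = ln r - ln (max s (cmod b))"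
    using 1 circle_mean_ln_dist[OF s(1) b(2)] r by (simp add: ln_realpow del: of_real_power)
  finally show ?thesis .
qed

text \<open>A weak form of Jordan's inequality. With 1/4 in place of 2/pi two crude cases suffice:
  the cosine is at least 1/2 up to pi/3, and beyond that the sine is at least 1/2 while x/4 <
  1/2.\<close>

lemma abs_sin_ge:
  assumes "\<bar>x\<bar> \<le> pi / 2"
  shows "\<bar>x\<bar> / 4 \<le> \<bar>sin x\<bar>"
proof -
  have *: "x / 4 \<le> sin x" if x: "0 \<le> x" "x \<le> pi / 2" for x :: real
  proof (cases "x \<le> pi / 3")
    case True
    have "0 / 4 - sin 0 \<ge> x / 4 - sin x"
    proof (rule DERIV_nonpos_imp_nonincreasing[OF x(1)])
      fix t assume t: "0 \<le> t" "t \<le> x"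
      have "cos (pi / 3) \<le> cos t"
        using t True pi_gt_zero by (intro cos_monotone_0_pi_le) auto
      then have "1 / 4 - cos t \<le> 0" by (simp add: cos_60)
      moreover have "((\<lambda>t. t / 4 - sin t) has_real_derivative 1 / 4 - cos t) (at t)"
        by (auto intro!: derivative_eq_intros)
      ultimately show "\<exists>y. ((\<lambda>a. a / 4 - sin a) has_real_derivative y) (at t) \<and> y \<le> 0" by blast
    qed
    then show ?thesis by simp
  next
    case False
    then have "sin (pi / 6) \<le> sin x"
      using x pi_gt_zero by (intro sin_monotone_2pi_le) auto
    then show ?thesis using x pi_less_4 by (simp add: sin_30)
  qed
  show ?thesis
  proof (cases "x \<ge> 0")
    case True
    then show ?thesis using *[of x] assms by linarith
  next
    case False
    then show ?thesis using *[of "-x"] assms by (simp add: abs_if)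
  qed
qed

text \<open>The integrand has an explicit antiderivative that extends continuously over the
  singularity at \<gamma>. Each endpoint contributes at most half of the bound.\<close>

lemma ln_one_plus_div_integral:
  fixes \<kappa> a b \<gamma> M :: real
  assumes \<kappa>: "\<kappa> > 0" and ab: "a \<le> b" "\<bar>a - \<gamma>\<bar> \<le> M" "\<bar>b - \<gamma>\<bar> \<le> M"
  shows "set_integrable lborel {a..b} (\<lambda>x. ln (1 + \<kappa> / \<bar>x - \<gamma>\<bar>))"
    and "(LINT x:{a..b}|lborel. ln (1 + \<kappa> / \<bar>x - \<gamma>\<bar>)) \<le> 2 * \<kappa> * (1 + ln (1 + M / \<kappa>))"
proof -
  define u where "u x = ln (1 + \<kappa> / \<bar>x - \<gamma>\<bar>)" for x
  \<comment> \<open>For x > 0 this is the antiderivative of ln (1 + \<kappa> / x) normalised by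
    \<open>G 0 = 0\<close>.\<close>
  define G where "G x = (\<bar>x\<bar> + \<kappa>) * ln (\<bar>x\<bar> + \<kappa>) - \<bar>x\<bar> * ln \<bar>x\<bar> - \<kappa> * ln \<kappa>" for x :: real
  \<comment> \<open>The odd extension of \<open>G\<close>, which is an antiderivative on both sides
    of the singularity.\<close>
  define F where "F x = G (max 0 x) - G (max 0 (-x))" for x
  have cont_xlnx: "isCont (\<lambda>x::real. \<bar>x\<bar> * ln \<bar>x\<bar>) x" for x
  proof (cases "x = 0")
    case True
    have "((\<lambda>x::real. \<bar>x\<bar> * ln \<bar>x\<bar>) \<longlongrightarrow> 0) (at_right 0)"
      "((\<lambda>x::real. \<bar>x\<bar> * ln \<bar>x\<bar>) \<longlongrightarrow> 0) (at_left 0)"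
      by real_asymp+
    then show ?thesis using True by (simp add: isCont_def filterlim_at_split)
  next
    case False
    then show ?thesis by (intro continuous_intros) auto
  qed
  have Gc: "isCont G x" for x
  proof -
    have "isCont (\<lambda>x. (\<bar>x\<bar> + \<kappa>) * ln (\<bar>x\<bar> + \<kappa>)) x"
      using \<kappa> by (intro continuous_intros) (auto simp: add_nonneg_eq_0_iff)
    then show ?thesis
      unfolding G_def by (intro continuous_diff cont_xlnx) auto
  qed
  have F0: "G 0 = 0" by (simp add: G_def)
  have Fc: "continuous_on UNIV F"
  proof -
    have "continuous_on UNIV G" using Gc by (auto intro: continuous_at_imp_continuous_on)
    then show ?thesis
      unfolding F_def by (auto intro!: continuous_intros continuous_on_compose2[of UNIV G])
  qed
  have dG: "(G has_real_derivative u (x + \<gamma>)) (at x)" if "x > 0" for x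
  proof -
    have "((\<lambda>x. (x + \<kappa>) * ln (x + \<kappa>) - x * ln x - \<kappa> * ln \<kappa>) has_real_derivative
            ln (x + \<kappa>) - ln x) (at x)"
      using that \<kappa> by (auto intro!: derivative_eq_intros)
    moreover have "ln (x + \<kappa>) - ln x = u (x + \<gamma>)"
    proof -
      have "1 + \<kappa> / x = (x + \<kappa>) / x" using that by (simp add: field_simps)
      then show ?thesis using that \<kappa> by (simp add: u_def ln_div)
    qed
    ultimately have *: "((\<lambda>x. (x + \<kappa>) * ln (x + \<kappa>) - x * ln x - \<kappa> * ln \<kappa>) has_real_derivative u (x + \<gamma>)) (at x)"
      by simp
    show ?thesis
      by (rule has_field_derivative_transform_within_open[OF *, of "{0<..}"]) (use that in \<open>auto simp: G_def\<close>)
  qed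
  have dF: "((\<lambda>x. F (x - \<gamma>)) has_real_derivative u x) (at x)" if "x \<noteq> \<gamma>" for x
  proof (cases "x > \<gamma>")
    case True
    have *: "((\<lambda>x. G (x - \<gamma>)) has_real_derivative u x) (at x)"
      using DERIV_shift[of G "u x" x "-\<gamma>"] dG[of "x - \<gamma>"] True by simp
    show ?thesis
      by (rule has_field_derivative_transform_within_open[OF *, of "{\<gamma><..}"]) (use True F0 in \<open>auto simp: F_def\<close>)
  next
    case False
    then have x: "x < \<gamma>" using that by simp
    have "((\<lambda>x. \<gamma> - x) has_real_derivative -1) (at x)"
      by (auto intro!: derivative_eq_intros)
    then have "((\<lambda>x. G (\<gamma> - x)) has_real_derivative u (\<gamma> - x + \<gamma>) * -1) (at x)"
      using dG[of "\<gamma> - x"] x by (intro DERIV_chain2[of G]) auto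
    then have *: "((\<lambda>x. - G (\<gamma> - x)) has_real_derivative - (u (\<gamma> - x + \<gamma>) * -1)) (at x)"
      by (rule DERIV_minus)
    have "((\<lambda>x. F (x - \<gamma>)) has_real_derivative - (u (\<gamma> - x + \<gamma>) * -1)) (at x)"
      by (rule has_field_derivative_transform_within_open[OF *, of "{..<\<gamma>}"]) (use x F0 in \<open>auto simp: F_def\<close>)
    moreover have "- (u (\<gamma> - x + \<gamma>) * -1) = u x"
      using x by (simp add: u_def abs_if)
    ultimately show ?thesis by simp
  qed
  have Gb: "0 \<le> G x" "G x \<le> \<kappa> * (1 + ln (1 + M / \<kappa>))" if x: "0 \<le> x" "x \<le> M" for x
  proof -
    have l: "ln (x + \<kappa>) = ln \<kappa> + ln (1 + x / \<kappa>)"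
    proof -
      have "x + \<kappa> = \<kappa> * (1 + x / \<kappa>)" using \<kappa> by (simp add: field_simps)
      moreover have "1 + x / \<kappa> > 0" using \<kappa> x by (intro add_pos_nonneg) auto
      ultimately show ?thesis using \<kappa> ln_mult_pos[of \<kappa> "1 + x / \<kappa>"] by simp
    qed
    have xl: "0 \<le> x * (ln (x + \<kappa>) - ln x)" "x * (ln (x + \<kappa>) - ln x) \<le> \<kappa>"
    proof -
      show "0 \<le> x * (ln (x + \<kappa>) - ln x)"
        using x \<kappa> by (cases "x = 0") auto
      show "x * (ln (x + \<kappa>) - ln x) \<le> \<kappa>"
      proof (cases "x = 0")
        case False
        then have "ln (x + \<kappa>) - ln x = ln (1 + \<kappa> / x)"
        proof -
          have "1 + \<kappa> / x = (x + \<kappa>) / x" using False by (simp add: field_simps)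
          then show ?thesis using x False \<kappa> by (simp add: ln_div)
        qed
        also have "\<dots> \<le> \<kappa> / x" using x \<kappa> by (intro ln_add_one_self_le_self) auto
        finally show ?thesis using x False by (simp add: field_simps)
      qed (use \<kappa> in auto)
    qed
    have "0 \<le> ln (1 + x / \<kappa>)" using x \<kappa> by simp
    then have 1: "0 \<le> \<kappa> * ln (1 + x / \<kappa>)" using \<kappa> by simp
    have "ln (1 + x / \<kappa>) \<le> ln (1 + M / \<kappa>)"
      using x \<kappa> by (subst ln_le_cancel_iff) (auto intro!: add_pos_nonneg divide_right_mono)
    then have 2: "\<kappa> * ln (1 + x / \<kappa>) \<le> \<kappa> * ln (1 + M / \<kappa>)" using \<kappa> by simp
    have "G x = x * (ln (x + \<kappa>) - ln x) + \<kappa> * ln (1 + x / \<kappa>)"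
      using x l by (simp add: G_def algebra_simps)
    then show "0 \<le> G x" "G x \<le> \<kappa> * (1 + ln (1 + M / \<kappa>))"
      using xl 1 2 by (simp_all add: algebra_simps)
  qed
  have Fb: "\<bar>F x\<bar> \<le> \<kappa> * (1 + ln (1 + M / \<kappa>))" if "\<bar>x\<bar> \<le> M" for x
    using Gb[of x] Gb[of "-x"] F0 that by (cases "x \<ge> 0") (auto simp: F_def max_def)
  have hi: "(u has_integral (F (b - \<gamma>) - F (a - \<gamma>))) {a..b}"
  proof (rule fundamental_theorem_of_calculus_interior_strong[of "{\<gamma>}"])
    show "continuous_on {a..b} (\<lambda>x. F (x - \<gamma>))"
      by (rule continuous_on_compose2[OF Fc]) (auto intro!: continuous_intros)
  qed (use ab dF in \<open>auto simp: has_real_derivative_iff_has_vector_derivative\<close>)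
  have nn: "0 \<le> u x" for x unfolding u_def using \<kappa> by (intro ln_ge_zero) auto
  \<comment> \<open>The fundamental theorem with one exceptional point gives only a gauge integral;
    nonnegativity of the integrand upgrades it to Lebesgue integrability.\<close>
  have "u absolutely_integrable_on {a..b}"
    by (rule nonnegative_absolutely_integrable_1) (use hi nn in \<open>auto simp: integrable_on_def\<close>)
  then show int: "set_integrable lborel {a..b} (\<lambda>x. ln (1 + \<kappa> / \<bar>x - \<gamma>\<bar>))"
    unfolding set_integrable_def u_def
    by (subst (asm) integrable_completion) auto
  have "(LINT x:{a..b}|lborel. ln (1 + \<kappa> / \<bar>x - \<gamma>\<bar>)) = F (b - \<gamma>) - F (a - \<gamma>)"
    using set_borel_integral_eq_integral(2)[OF int] integral_unique[OF hi] by (simp only: u_def[abs_def])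
  also have "\<dots> \<le> 2 * \<kappa> * (1 + ln (1 + M / \<kappa>))"
    using Fb[of "b - \<gamma>"] Fb[of "a - \<gamma>"] ab by linarith
  finally show "(LINT x:{a..b}|lborel. ln (1 + \<kappa> / \<bar>x - \<gamma>\<bar>)) \<le> 2 * \<kappa> * (1 + ln (1 + M / \<kappa>))" .
qed

text \<open>The distance to \<open>b\<close> is at least the distance to the line through 0 and
  \<open>b\<close>: rotate \<open>b\<close> onto the real axis and keep the imaginary part.\<close>

lemma cmod_circle_minus_ge:
  assumes "r \<ge> 0"
  shows "r * \<bar>sin (\<theta> - Arg b)\<bar> \<le> cmod (of_real r * cis \<theta> - b)"
proof -
  have "of_real r * cis \<theta> - b = cis (Arg b) * (of_real r * cis (\<theta> - Arg b) - of_real (cmod b))"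
    using rcis_cmod_Arg[of b] by (simp add: rcis_def algebra_simps cis_mult)
  then have "cmod (of_real r * cis \<theta> - b) = cmod (of_real r * cis (\<theta> - Arg b) - of_real (cmod b))"
    by (simp only: norm_mult norm_cis mult_1)
  moreover have "\<bar>Im (of_real r * cis (\<theta> - Arg b) - of_real (cmod b))\<bar> = r * \<bar>sin (\<theta> - Arg b)\<bar>"
    using assms by (simp add: abs_mult)
  ultimately show ?thesis
    using abs_Im_le_cmod by metis
qed

text \<open>The source of the factor ln r / r. Near an angle at which the circle meets the line
  through 0 and \<open>b\<close>, the distance to \<open>b\<close> is at least r/4 times the angular
  distance, so the integrand is at most ln (1 + \<kappa> / |\<theta> - \<gamma>|) with \<kappa> of
  size 1/r. The bound is uniform in \<open>b\<close>.\<close>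

lemma circle_mean_ln_one_plus:
  assumes C: "C \<ge> 1" and r: "r \<ge> 3"
  shows "circle_integrable r (\<lambda>z. ln (1 + C / cmod (z - b)))"
    and "circle_mean r (\<lambda>z. ln (1 + C / cmod (z - b))) \<le> 32 * C * ln r / r"
proof -
  define \<kappa> where "\<kappa> = 4 * C / r"
  define \<gamma> where "\<gamma> m = Arg b + of_int m * pi" for m :: int
  define u where "u \<theta> = ln (1 + C / cmod (of_real r * cis \<theta> - b))" for \<theta>
  define v where "v m \<theta> = ln (1 + \<kappa> / \<bar>\<theta> - \<gamma> m\<bar>)" for m \<theta>
  \<comment> \<open>The quotient (\<theta> - Arg b) / pi ranges over part of [-1, 3), so its nearest
    integer is one of these.\<close>
  define I :: "int set" where "I = {-1, 0, 1, 2, 3}"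
  have \<kappa>: "\<kappa> > 0" using C r by (simp add: \<kappa>_def)
  have v0: "0 \<le> v m \<theta>" for m \<theta> unfolding v_def using \<kappa> by (intro ln_ge_zero) auto
  have u0: "0 \<le> u \<theta>" for \<theta> unfolding u_def using C by (intro ln_ge_zero) auto
  \<comment> \<open>The nearest angle depends on \<theta>; summing over all candidates removes this
    dependence.\<close>
  have uv: "u \<theta> \<le> (\<Sum>m\<in>I. v m \<theta>)" if \<theta>: "0 \<le> \<theta>" "\<theta> \<le> 2 * pi" "\<And>m. \<theta> \<noteq> \<gamma> m" for \<theta>
  proof -
    define x where "x = \<theta> - Arg b"
    define m where "m = round (x / pi)"
    have A: "-pi < Arg b" "Arg b \<le> pi" using Arg_bounded[of b] by auto
    have m1: "\<bar>x / pi - of_int m\<bar> \<le> 1 / 2"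
      unfolding m_def using of_int_round_abs_le[of "x / pi"] by (simp add: abs_minus_commute)
    then have "\<bar>x / pi - of_int m\<bar> * pi \<le> 1 / 2 * pi"
      by (intro mult_right_mono) auto
    moreover have "\<bar>x / pi - of_int m\<bar> * pi = \<bar>(x / pi - of_int m) * pi\<bar>"
      by (simp add: abs_mult)
    ultimately have m2: "\<bar>x - of_int m * pi\<bar> \<le> pi / 2" by (simp add: left_diff_distrib)
    have "-1 \<le> x / pi" "x / pi < 3"
      using A \<theta> by (auto simp: x_def field_simps)
    then have "of_int m < (4 :: real)" "of_int m > (-2 :: real)"
      using m1 by linarith+
    then have mI: "m \<in> I" unfolding I_def by auto
    have "\<bar>sin x\<bar> = \<bar>sin (x - of_int m * pi)\<bar>"
    proof -
      have "sin (of_int m * pi) = 0" by (metis sin_zero_iff_int2)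
      then have "\<bar>cos (of_int m * pi)\<bar> = 1" by (simp add: sin_zero_abs_cos_one)
      then show ?thesis using \<open>sin (of_int m * pi) = 0\<close> by (simp add: sin_diff abs_mult)
    qed
    then have s: "\<bar>\<theta> - \<gamma> m\<bar> / 4 \<le> \<bar>sin x\<bar>"
      using abs_sin_ge[OF m2] by (simp add: \<gamma>_def x_def algebra_simps)
    have d: "r * (\<bar>\<theta> - \<gamma> m\<bar> / 4) \<le> cmod (of_real r * cis \<theta> - b)"
      using cmod_circle_minus_ge[of r \<theta> b] mult_left_mono[OF s, of r] r unfolding x_def by linarith
    have d0: "0 < r * (\<bar>\<theta> - \<gamma> m\<bar> / 4)" using \<theta>(3)[of m] r by simp
    have "C / cmod (of_real r * cis \<theta> - b) \<le> C / (r * (\<bar>\<theta> - \<gamma> m\<bar> / 4))"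
      using C by (intro divide_left_mono[OF d] mult_pos_pos[OF order_less_le_trans[OF d0 d] d0]) auto
    also have "\<dots> = \<kappa> / \<bar>\<theta> - \<gamma> m\<bar>" by (simp add: \<kappa>_def)
    finally have "u \<theta> \<le> v m \<theta>"
      unfolding u_def v_def using C by (intro ln_mono) (auto intro: add_pos_nonneg)
    also have "\<dots> \<le> (\<Sum>m\<in>I. v m \<theta>)"
      using mI v0 by (intro member_le_sum) (auto simp: I_def)
    finally show ?thesis .
  qed
  \<comment> \<open>At \<theta> = \<gamma> m the majorant takes the default value ln (1 + 0) = 0, so
    the domination is claimed only almost everywhere.\<close>
  have ae: "AE \<theta> in lborel. \<forall>m. \<theta> \<noteq> \<gamma> m"
    using AE_lborel_singleton by (subst AE_all_countable) auto
  \<comment> \<open>Both distances are at most 4 pi < 16.\<close>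
  have \<gamma>: "\<bar>0 - \<gamma> m\<bar> \<le> 16" "\<bar>2 * pi - \<gamma> m\<bar> \<le> 16" if "m \<in> I" for m
    using that Arg_bounded[of b] pi_less_4 pi_gt_zero by (auto simp: I_def \<gamma>_def)
  note vint = ln_one_plus_div_integral[OF \<kappa> _ \<gamma>, folded v_def]
  have iv: "set_integrable lborel {0..2*pi} (\<lambda>\<theta>. \<Sum>m\<in>I. v m \<theta>)"
    unfolding set_integrable_def scaleR_sum_right
    by (intro Bochner_Integration.integrable_sum) (use vint(1) pi_gt_zero in \<open>auto simp: set_integrable_def\<close>)
  have um: "(\<lambda>\<theta>. indicator {0..2*pi} \<theta> *\<^sub>R u \<theta>) \<in> borel_measurable lborel"
  proof -
    have [measurable]: "cis \<in> borel_measurable borel"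
      by (intro borel_measurable_continuous_onI continuous_intros)
    show ?thesis unfolding u_def by measurable
  qed
  have iu: "set_integrable lborel {0..2*pi} u"
    unfolding set_integrable_def
  proof (rule Bochner_Integration.integrable_bound[OF iv[unfolded set_integrable_def] um])
    show "AE \<theta> in lborel. norm (indicat_real {0..2 * pi} \<theta> *\<^sub>R u \<theta>)
            \<le> norm (indicat_real {0..2 * pi} \<theta> *\<^sub>R (\<Sum>m\<in>I. v m \<theta>))"
      using ae by eventually_elim (use uv u0 v0 in \<open>auto simp: indicator_def sum_nonneg\<close>)
  qed
  then show "circle_integrable r (\<lambda>z. ln (1 + C / cmod (z - b)))" by (simp only: u_def[abs_def])
  have "(LINT \<theta>:{0..2*pi}|lborel. u \<theta>) \<le> (LINT \<theta>:{0..2*pi}|lborel. \<Sum>m\<in>I. v m \<theta>)"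
    unfolding set_lebesgue_integral_def
  proof (rule integral_mono_AE[OF iu[unfolded set_integrable_def] iv[unfolded set_integrable_def]])
    show "AE \<theta> in lborel. indicat_real {0..2 * pi} \<theta> *\<^sub>R u \<theta> \<le> indicat_real {0..2 * pi} \<theta> *\<^sub>R (\<Sum>m\<in>I. v m \<theta>)"
      using ae by eventually_elim (use uv in \<open>auto simp: indicator_def\<close>)
  qed
  also have "\<dots> = (\<Sum>m\<in>I. LINT \<theta>:{0..2*pi}|lborel. v m \<theta>)"
    unfolding set_lebesgue_integral_def scaleR_sum_right
    by (intro Bochner_Integration.integral_sum) (use vint(1) pi_gt_zero in \<open>auto simp: set_integrable_def\<close>)
  also have "\<dots> \<le> (\<Sum>m\<in>I. 2 * \<kappa> * (1 + ln (1 + 16 / \<kappa>)))"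
    by (intro sum_mono vint(2)) (use pi_gt_zero in auto)
  also have "\<dots> = 10 * \<kappa> * (1 + ln (1 + 16 / \<kappa>))" by (simp add: I_def)
  finally have 1: "(LINT \<theta>:{0..2*pi}|lborel. u \<theta>) \<le> 10 * \<kappa> * (1 + ln (1 + 16 / \<kappa>))" .
  have l0: "0 \<le> ln (1 + 16 / \<kappa>)" using \<kappa> by simp
  have "circle_mean r (\<lambda>z. ln (1 + C / cmod (z - b))) \<le> 1 / (2 * pi) * (10 * \<kappa> * (1 + ln (1 + 16 / \<kappa>)))"
    unfolding circle_mean_def using 1 pi_gt_zero by (intro mult_left_mono) (auto simp: u_def)
  also have "\<dots> \<le> 1 / 6 * (10 * \<kappa> * (1 + ln (1 + 16 / \<kappa>)))"
    using \<kappa> l0 pi_gt3 by (intro mult_right_mono divide_left_mono) auto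
  also have "\<dots> \<le> 2 * \<kappa> * (1 + ln (1 + 16 / \<kappa>))"
    using \<kappa> l0 by (simp add: mult_right_mono)
  \<comment> \<open>Here 1 + 16/\<kappa> <= 1 + 4r <= 9r <= r^3, and ln r >= 1, since r >=
    3.\<close>
  also have "1 + ln (1 + 16 / \<kappa>) \<le> 4 * ln r"
  proof -
    have "1 + 16 / \<kappa> \<le> 1 + 4 * r" using C r by (simp add: \<kappa>_def field_simps)
    also have "\<dots> \<le> r ^ 3"
    proof -
      have "1 + 4 * r \<le> 9 * r" using r by simp
      also have "\<dots> \<le> r\<^sup>2 * r" using r power_mono[of 3 r 2] by (intro mult_right_mono) auto
      finally show ?thesis by (simp add: power2_eq_square power3_eq_cube)
    qed
    finally have "ln (1 + 16 / \<kappa>) \<le> ln (r ^ 3)" using \<kappa> by (intro ln_mono) (auto intro: add_pos_nonneg)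
    also have "\<dots> = 3 * ln r" using r by (simp add: ln_realpow)
    finally have "ln (1 + 16 / \<kappa>) \<le> 3 * ln r" .
    moreover have "1 \<le> ln r"
      using exp_le r by (subst ln_ge_iff) auto
    ultimately show ?thesis by simp
  qed
  also have "2 * \<kappa> * (4 * ln r) = 32 * C * ln r / r" by (simp add: \<kappa>_def)
  finally show "circle_mean r (\<lambda>z. ln (1 + C / cmod (z - b))) \<le> 32 * C * ln r / r"
    using \<kappa> by simp
qed

section \<open>Zeros, poles and the Poisson-Jensen formula\<close>

lemma ln_power_int: "x > 0 \<Longrightarrow> ln (x powi n) = of_int n * ln (x :: real)"
  by (simp flip: powr_real_of_int' add: ln_powr)

locale nonconstant_meromorphic =
  fixes f :: "complex \<Rightarrow> complex"
  assumes mero: "f nicely_meromorphic_on UNIV"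
    and nonconst: "\<not> f constant_on UNIV"
begin

lemma eventually_nonzero: "eventually (\<lambda>w. f w \<noteq> 0) (at z)"
proof -
  have "(\<forall>x\<in>UNIV. f x = 0) \<or> (\<forall>\<^sub>\<approx>x\<in>UNIV. f x \<noteq> 0)"
    by (rule nicely_meromorphic_imp_constant_or_avoid[OF mero]) auto
  then have "\<forall>\<^sub>\<approx>x\<in>UNIV. f x \<noteq> 0"
    using nonconst by (auto simp: constant_on_def)
  then show ?thesis
    by (auto intro: eventually_cosparse_imp_eventually_at)
qed

text \<open>Since \<open>f\<close> is nicely meromorphic, it vanishes at its poles as well: the points where \<open>f\<close> is
  \<open>0\<close> are the zeros and the poles.\<close>

lemma finite_zeros: "finite {z. f z = 0 \<and> cmod z \<le> r}"
proof -
  have "{z. f z = 0} sparse_in UNIV"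
    using eventually_nonzero unfolding sparse_in_def islimpt_conv_frequently_at frequently_def
    by (auto elim: eventually_mono)
  then have "finite (cball 0 r \<inter> {z. f z = 0})"
    by (intro sparse_in_compact_finite) (auto intro: sparse_in_subset)
  then show ?thesis by (rule finite_subset[rotated]) auto
qed

lemma isolated_sing: "isolated_singularity_at f z" and not_essential: "not_essential f z"
  using mero unfolding nicely_meromorphic_on_def
  by (auto intro: meromorphic_on_isolated_singularity meromorphic_on_not_essential meromorphic_on_subset)

lemma zor_poly:
  "zor_poly f z z \<noteq> 0"
  "\<exists>r>0. zor_poly f z holomorphic_on cball z r \<and>
     (\<forall>w\<in>cball z r - {z}. f w = zor_poly f z w * (w - z) powi zorder f z \<and> zor_poly f z w \<noteq> 0)"
  using zorder_exist[OF isolated_sing not_essential, of z] eventually_frequently[OF _ eventually_nonzero[of z]]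
  by auto

lemma pole_imp_zero: "is_pole f z \<Longrightarrow> f z = 0"
  using is_pole_zero_at_nicely_mero[OF mero] by simp

lemma analytic_nonzero: "f z \<noteq> 0 \<Longrightarrow> f analytic_on {z}"
  using nicely_meromorphic_on_imp_analytic_at[OF mero] pole_imp_zero by auto

lemma zorder_nonzero: "f z \<noteq> 0 \<Longrightarrow> zorder f z = 0"
  using analytic_nonzero by (rule zorder_eq_0I)

lemma is_pole_iff_zorder: "is_pole f z \<longleftrightarrow> zorder f z < 0"
  using isolated_pole_imp_neg_zorder[OF isolated_sing] neg_zorder_imp_is_pole[OF isolated_sing not_essential]
    eventually_frequently[OF _ eventually_nonzero[of z]] by auto

lemma isCont_nonzero: "f z \<noteq> 0 \<Longrightarrow> isCont f z"
  using analytic_nonzero analytic_at_imp_isCont by blast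

text \<open>The order is 0, so both functions agree near z except possibly at z, and both are
  continuous there.\<close>

lemma zor_poly_nonzero: "f z \<noteq> 0 \<Longrightarrow> zor_poly f z z = f z"
proof -
  assume nz: "f z \<noteq> 0"
  obtain r where r: "r > 0" "zor_poly f z holomorphic_on cball z r"
    "\<forall>w\<in>cball z r - {z}. f w = zor_poly f z w * (w - z) powi zorder f z"
    using zor_poly(2)[of z] by auto
  have "isCont (zor_poly f z) z"
    using r by (metis centre_in_ball continuous_on_interior holomorphic_on_imp_continuous_on interior_cball)
  then have "(zor_poly f z \<longlongrightarrow> zor_poly f z z) (at z)" by (simp add: isCont_def)
  moreover have "eventually (\<lambda>w. w \<in> ball z r - {z}) (at z)"
    using r eventually_at_ball'[of r z UNIV] by auto
  then have "eventually (\<lambda>w. zor_poly f z w = f w) (at z)"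
    by eventually_elim (use r(3) zorder_nonzero[OF nz] in auto)
  ultimately have "(f \<longlongrightarrow> zor_poly f z z) (at z)" by (rule Lim_transform_eventually)
  moreover have "(f \<longlongrightarrow> f z) (at z)" using isCont_nonzero[OF nz] by (simp add: isCont_def)
  ultimately show "zor_poly f z z = f z" by (intro LIM_unique)
qed

text \<open>This excludes poles on the circle as well, since \<open>f\<close> is 0 there; ln |f| is
  then continuous on the circle.\<close>

definition generic :: "real \<Rightarrow> bool" where
  "generic r \<longleftrightarrow> (\<forall>z. cmod z = r \<longrightarrow> f z \<noteq> 0)"

text \<open>Zeros and poles together: weighted by the signed \<open>zorder\<close>, they need only
  one sum in the Poisson-Jensen formula.\<close>

definition zeros :: "real \<Rightarrow> complex set" where
  "zeros r = {a. f a = 0 \<and> cmod a < r}"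

lemma finite_zeros_ball [simp, intro]: "finite (zeros r)"
  by (rule finite_subset[OF _ finite_zeros[of r]]) (auto simp: zeros_def)

lemma continuous_on_ln_f: "generic r \<Longrightarrow> continuous_on (sphere 0 r) (\<lambda>w. ln (cmod (f w)))"
  by (intro continuous_at_imp_continuous_on ballI continuous_intros isCont_nonzero) (auto simp: generic_def)

text \<open>This is \<open>f\<close> divided by the monomials \<open>z - a\<close> of its zeros and poles in the disc.\<close>

definition zero_free_part :: "real \<Rightarrow> complex \<Rightarrow> complex" where
  "zero_free_part r z = zor_poly f z z * (\<Prod>a\<in>zeros r - {z}. (z - a) powi (- zorder f a))"

text \<open>Near a point p, the factorisation of \<open>f\<close> at p cancels the monomial of p,
  and the other monomials do not vanish. The margin beyond r exists because none of the finitely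
  many zeros and poles up to modulus r + 1 lies on the circle itself.\<close>

lemma zero_free_part_holomorphic:
  assumes "generic r"
  obtains r' where "r' > r" "zero_free_part r holomorphic_on ball 0 r'" "\<And>w. cmod w < r' \<Longrightarrow> zero_free_part r w \<noteq> 0"
proof -
  \<comment> \<open>The entry r + 1 keeps the set nonempty and caps its minimum.\<close>
  define M where "M = insert (r + 1) (cmod ` {z. f z = 0 \<and> r < cmod z \<and> cmod z \<le> r + 1})"
  have finM: "finite M"
    unfolding M_def by (intro finite.insertI finite_imageI finite_subset[OF _ finite_zeros[of "r + 1"]]) auto
  define r' where "r' = Min M"
  have r': "r' > r" unfolding r'_def using finM by (subst Min_gr_iff) (auto simp: M_def)
  have nz: "a \<in> zeros r" if "f a = 0" "cmod a < r'" for a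
  proof -
    have "r' \<le> r + 1" unfolding r'_def using finM by (intro Min_le) (auto simp: M_def)
    moreover have "cmod a \<notin> M" using Min_le[OF finM, of "cmod a"] that(2) by (auto simp: r'_def)
    ultimately show ?thesis using that assms by (force simp: M_def zeros_def generic_def)
  qed
  have ana: "zero_free_part r analytic_on {p}" if p: "cmod p < r'" for p
  proof -
    obtain \<rho> where \<rho>: "\<rho> > 0" "zor_poly f p holomorphic_on cball p \<rho>"
      "\<And>w. w \<in> cball p \<rho> - {p} \<Longrightarrow> f w = zor_poly f p w * (w - p) powi zorder f p \<and> zor_poly f p w \<noteq> 0"
      using zor_poly(2)[of p] by auto
    have fnz: "f w \<noteq> 0" if "w \<in> ball p \<rho>" "w \<noteq> p" for w
      using \<rho>(3)[of w] that by (auto simp: power_int_eq_0_iff)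
    \<comment> \<open>In \<open>zero_free_part r w\<close> the factor \<open>zor_poly\<close>
      belongs to the moving point w; here it is frozen at p, which makes holomorphy visible.\<close>
    define h where "h w = zor_poly f p w * (\<Prod>a\<in>zeros r - {p}. (w - a) powi (- zorder f a))" for w
    have "h holomorphic_on ball p \<rho>"
      unfolding h_def
    proof (intro holomorphic_on_mult holomorphic_on_prod holomorphic_on_power_int)
      fix a assume "a \<in> zeros r - {p}"
      then show "0 \<le> - zorder f a \<or> (\<forall>w\<in>ball p \<rho>. w - a \<noteq> 0)" using fnz by (auto simp: zeros_def)
    qed (auto intro!: holomorphic_intros holomorphic_on_subset[OF \<rho>(2)])
    moreover have "zero_free_part r w = h w" if w: "w \<in> ball p \<rho>" for w
    proof (cases "w = p")
      case True
      then show ?thesis by (simp add: h_def zero_free_part_def)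
    next
      case False
      have fw: "f w \<noteq> 0" using fnz w False by auto
      have "zero_free_part r w = f w * (\<Prod>a\<in>zeros r. (w - a) powi (- zorder f a))"
        using fw by (auto simp: zero_free_part_def zor_poly_nonzero zeros_def intro!: prod.cong)
      also have "(\<Prod>a\<in>zeros r. (w - a) powi (- zorder f a)) =
          (w - p) powi (- zorder f p) * (\<Prod>a\<in>zeros r - {p}. (w - a) powi (- zorder f a))"
      proof (cases "p \<in> zeros r")
        case True
        then show ?thesis by (subst prod.remove[of _ p]) auto
      next
        case False
        then have "f p \<noteq> 0" using nz p by auto
        then show ?thesis using False by (simp add: zorder_nonzero)
      qed
      also have "f w = zor_poly f p w * (w - p) powi zorder f p"
        using \<rho>(3)[of w] w False by auto
      finally show ?thesis using False by (simp add: h_def power_int_minus)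
    qed
    ultimately have "zero_free_part r holomorphic_on ball p \<rho>"
      by (metis holomorphic_transform)
    then show ?thesis using \<rho>(1) by (meson analytic_at centre_in_ball open_ball)
  qed
  show ?thesis
  proof
    show "zero_free_part r holomorphic_on ball 0 r'"
      using ana by (intro analytic_imp_holomorphic) (subst analytic_on_analytic_at, auto)
    show "zero_free_part r w \<noteq> 0" if "cmod w < r'" for w
      unfolding zero_free_part_def using zor_poly(1)[of w] by (auto simp: power_int_eq_0_iff)
  qed (rule r')
qed

lemma ln_f_eq:
  assumes "f z \<noteq> 0"
  shows "ln (cmod (f z)) = ln (cmod (zero_free_part r z)) + (\<Sum>a\<in>zeros r. zorder f a * ln (cmod (z - a)))"
proof -
  have nz: "z - a \<noteq> 0" if "a \<in> zeros r" for a using that assms by (auto simp: zeros_def)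
  have "zero_free_part r z = f z * (\<Prod>a\<in>zeros r. (z - a) powi (- zorder f a))"
    using assms by (auto simp: zero_free_part_def zor_poly_nonzero zeros_def intro!: prod.cong)
  then have "cmod (zero_free_part r z) = cmod (f z) * (\<Prod>a\<in>zeros r. cmod (z - a) powi (- zorder f a))"
    by (simp add: norm_mult norm_power_int flip: prod_norm)
  moreover have "(\<Prod>a\<in>zeros r. cmod (z - a) powi (- zorder f a)) > 0"
    using nz by (intro prod_pos) auto
  moreover have "ln (\<Prod>a\<in>zeros r. cmod (z - a) powi (- zorder f a)) = (\<Sum>a\<in>zeros r. - (zorder f a * ln (cmod (z - a))))"
    using nz by (subst ln_prod) (auto simp: ln_power_int)
  ultimately show ?thesis
    using assms ln_mult_pos[of "cmod (f z)"] by (simp add: sum_negf)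
qed

text \<open>The Poisson formula for the zero-free part, plus \<open>poisson_ln_dist\<close> for each
  monomial. The point z may itself be a zero or a pole, which is what Jensen's formula needs at z =
  0.\<close>

lemma poisson_ln_f:
  assumes R: "generic R" and z: "cmod z < R"
  shows "circle_mean R (\<lambda>w. poisson_kernel z w * ln (cmod (f w))) =
    ln (cmod (zero_free_part R z)) + (\<Sum>a\<in>zeros R. zorder f a * (ln (cmod (of_real (R\<^sup>2) - cnj a * z)) - ln R))"
proof -
  have R0: "R > 0" using z norm_ge_zero[of z] by linarith
  obtain R' where R': "R' > R" "zero_free_part R holomorphic_on ball 0 R'" "\<And>w. cmod w < R' \<Longrightarrow> zero_free_part R w \<noteq> 0"
    using zero_free_part_holomorphic[OF R] by blast
  have fR: "f w \<noteq> 0" if "cmod w = R" for w using R that by (auto simp: generic_def)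
  have S: "cmod a < R" if "a \<in> zeros R" for a using that by (auto simp: zeros_def)
  have nz: "w \<noteq> a" if "a \<in> zeros R" "cmod w = R" for a w using S[OF that(1)] that(2) by auto
  have i1: "circle_integrable R (\<lambda>w. poisson_kernel z w * ln (cmod (zero_free_part R w)))"
  proof (intro circle_integrable_continuous)
    have "sphere 0 R \<subseteq> ball 0 R'" using R'(1) by auto
    from holomorphic_on_imp_continuous_on[OF holomorphic_on_subset[OF R'(2) this]]
    show "continuous_on (sphere 0 \<bar>R\<bar>) (\<lambda>w. poisson_kernel z w * ln (cmod (zero_free_part R w)))"
      using R0 z R' by (auto intro!: continuous_intros continuous_on_poisson_kernel)
  qed
  have i2: "circle_integrable R (\<lambda>w. real_of_int (zorder f a) * (poisson_kernel z w * ln (cmod (w - a))))" if "a \<in> zeros R" for a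
    using R0 z nz[OF that]
    by (intro circle_integrable_continuous) (auto intro!: continuous_intros continuous_on_poisson_kernel)
  have "circle_mean R (\<lambda>w. poisson_kernel z w * ln (cmod (f w))) =
        circle_mean R (\<lambda>w. poisson_kernel z w * ln (cmod (zero_free_part R w)) +
           (\<Sum>a\<in>zeros R. real_of_int (zorder f a) * (poisson_kernel z w * ln (cmod (w - a)))))"
    by (rule circle_mean_cong)
       (use R0 in \<open>simp add: ln_f_eq[OF fR, of _ R] distrib_left sum_distrib_left mult.left_commute\<close>)
  also have "\<dots> = circle_mean R (\<lambda>w. poisson_kernel z w * ln (cmod (zero_free_part R w))) +
     (\<Sum>a\<in>zeros R. zorder f a * circle_mean R (\<lambda>w. poisson_kernel z w * ln (cmod (w - a))))"
    using circle_mean_add[OF i1 circle_integrable_sum[OF i2, of "zeros R" "\<lambda>a. a"]]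
      circle_mean_sum[OF i2, of "zeros R" "\<lambda>a. a"]
    by (simp add: circle_mean_cmult)
  also have "circle_mean R (\<lambda>w. poisson_kernel z w * ln (cmod (zero_free_part R w))) = ln (cmod (zero_free_part R z))"
    by (rule poisson_formula_ln[OF R'(2,3,1) z])
  also have "(\<Sum>a\<in>zeros R. zorder f a * circle_mean R (\<lambda>w. poisson_kernel z w * ln (cmod (w - a)))) =
     (\<Sum>a\<in>zeros R. zorder f a * (ln (cmod (of_real (R\<^sup>2) - cnj a * z)) - ln R))"
    by (intro sum.cong refl) (simp only: poisson_ln_dist[OF S z])
  finally show ?thesis .
qed

lemma poisson_jensen:
  assumes R: "generic R" and z: "cmod z < R" and fz: "f z \<noteq> 0"
  shows "ln (cmod (f z)) = circle_mean R (\<lambda>w. poisson_kernel z w * ln (cmod (f w))) -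
            (\<Sum>a\<in>zeros R. zorder f a * green R z a)"
  unfolding poisson_ln_f[OF R z] ln_f_eq[OF fz, of R] green_def
  by (simp add: right_diff_distrib sum_subtractf)

text \<open>The case \<open>a = 0\<close> contributes \<open>ln R\<close>, because \<open>ln 0 = 0\<close>.\<close>

lemma jensen:
  assumes R: "generic R" "R > 0"
  shows "circle_mean R (\<lambda>w. ln (cmod (f w))) =
           ln (cmod (zor_poly f 0 0)) + (\<Sum>a\<in>zeros R. zorder f a * (ln R - ln (cmod a)))"
proof -
  have pos: "(\<Prod>a\<in>zeros R - {0}. cmod a powi (- zorder f a)) > 0"
    by (intro prod_pos) auto
  have "cmod (zero_free_part R 0) = cmod (zor_poly f 0 0) * (\<Prod>a\<in>zeros R - {0}. cmod a powi (- zorder f a))"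
    by (simp add: zero_free_part_def norm_mult norm_power_int flip: prod_norm)
  then have "ln (cmod (zero_free_part R 0)) = ln (cmod (zor_poly f 0 0)) + ln (\<Prod>a\<in>zeros R - {0}. cmod a powi (- zorder f a))"
    using zor_poly(1)[of 0] pos by (simp add: ln_mult)
  also have "ln (\<Prod>a\<in>zeros R - {0}. cmod a powi (- zorder f a)) = (\<Sum>a\<in>zeros R - {0}. - (zorder f a * ln (cmod a)))"
    by (subst ln_prod) (auto simp: ln_power_int)
  also have "\<dots> = (\<Sum>a\<in>zeros R. - (zorder f a * ln (cmod a)))"
    by (intro sum.mono_neutral_left) auto
  finally have 1: "ln (cmod (zero_free_part R 0)) = ln (cmod (zor_poly f 0 0)) + (\<Sum>a\<in>zeros R. - (zorder f a * ln (cmod a)))" .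
  have "circle_mean R (\<lambda>w. ln (cmod (f w))) = circle_mean R (\<lambda>w. poisson_kernel 0 w * ln (cmod (f w)))"
    by (rule circle_mean_cong) (use R in auto)
  also have "\<dots> = ln (cmod (zero_free_part R 0)) + (\<Sum>a\<in>zeros R. zorder f a * (ln (cmod (of_real (R\<^sup>2) - cnj a * 0)) - ln R))"
    by (rule poisson_ln_f) (use R in auto)
  finally show ?thesis
    unfolding 1 using R by (simp add: norm_power ln_realpow right_diff_distrib sum_subtractf sum_negf)
qed

end

section \<open>Effect of a shift on the Poisson and Green kernels\<close>

lemma poisson_kernel_eq_Re:
  assumes "w \<noteq> z"
  shows "poisson_kernel z w = Re ((w + z) / (w - z))"
proof -
  have "Re ((w + z) * cnj (w - z)) = (cmod w)\<^sup>2 - (cmod z)\<^sup>2"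
    by (simp only: cmod_power2) (simp add: algebra_simps power2_eq_square)
  then show ?thesis
    by (subst complex_div_cnj) (simp add: poisson_kernel_def Re_divide_of_real flip: of_real_power)
qed

text \<open>The kernel is the real part of (w + z) / (w - z), whose change under the shift is
  exactly 2wc / ((w - z - c) (w - z)). As |c| is at most half the distance from z to the circle, |w
  - z - c| >= |w - z| / 2.\<close>

lemma poisson_kernel_diff_le:
  assumes w: "cmod w = R" and z: "cmod z < R" and c: "2 * cmod c \<le> R - cmod z"
  shows "\<bar>poisson_kernel (z + c) w - poisson_kernel z w\<bar> \<le> 4 * cmod c * R / (cmod (w - z))\<^sup>2"
proof -
  define d where "d = cmod (w - z)"
  have R: "R > 0" using z norm_ge_zero[of z] by linarith
  have d: "d \<ge> R - cmod z" "d > 0"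
    using norm_triangle_ineq2[of w z] w z by (auto simp: d_def)
  have d2: "cmod (w - z - c) \<ge> d / 2"
    using norm_triangle_ineq2[of "w - z" c] d c by (simp add: d_def)
  have nz: "w - z \<noteq> 0" "w - z - c \<noteq> 0" using d d2 by (auto simp: d_def)
  have "poisson_kernel (z + c) w - poisson_kernel z w = Re ((w + (z + c)) / (w - (z + c)) - (w + z) / (w - z))"
    using nz poisson_kernel_eq_Re[of w z] poisson_kernel_eq_Re[of w "z + c"] by (auto simp: algebra_simps)
  also have "(w + (z + c)) / (w - (z + c)) - (w + z) / (w - z) = 2 * w * c / ((w - z - c) * (w - z))"
    using nz by (simp add: divide_simps) (simp add: algebra_simps)
  also have "\<bar>Re \<dots>\<bar> \<le> cmod (2 * w * c / ((w - z - c) * (w - z)))"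
    by (rule abs_Re_le_cmod)
  also have "\<dots> = 2 * R * cmod c / (cmod (w - z - c) * d)"
    by (simp add: norm_mult norm_divide w d_def)
  also have "\<dots> \<le> 2 * R * cmod c / (d / 2 * d)"
    using d d2 R by (intro divide_left_mono mult_right_mono) (auto intro!: mult_nonneg_nonneg mult_pos_pos)
  also have "\<dots> = 4 * cmod c * R / (cmod (w - z))\<^sup>2"
    by (simp add: d_def power2_eq_square)
  finally show ?thesis .
qed

text \<open>After the exchange of means, the inner mean of 1 / |w - z|^2 does not depend on w. The
  numerator of the Poisson kernel is constant for |z| = s and |w| = r, and cancels this
  mean.\<close>

lemma circle_mean_poisson_kernel_swap:
  assumes s: "0 < s" "s < r" and g: "continuous_on (sphere 0 r) g"
  shows "circle_mean s (\<lambda>z. circle_mean r (\<lambda>w. poisson_kernel z w * g w)) = circle_mean r g"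
    and "circle_integrable s (\<lambda>z. circle_mean r (\<lambda>w. poisson_kernel z w * g w))"
    and "circle_mean s (\<lambda>z. circle_mean r (\<lambda>w. a / (cmod (w - z))\<^sup>2 * g w)) = a / (r\<^sup>2 - s\<^sup>2) * circle_mean r g"
    and "circle_integrable s (\<lambda>z. circle_mean r (\<lambda>w. a / (cmod (w - z))\<^sup>2 * g w))"
proof -
  have ne: "w \<noteq> z" if "cmod z = s" "cmod w = r" for z w using that s by auto
  have g': "continuous_on (sphere 0 s \<times> sphere 0 r) (\<lambda>p. g (snd p))"
    by (rule continuous_on_compose2[OF g]) (auto intro!: continuous_intros)
  have c1: "continuous_on (sphere 0 \<bar>s\<bar> \<times> sphere 0 \<bar>r\<bar>) (\<lambda>(z, w). poisson_kernel z w * g w)"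
    unfolding case_prod_unfold poisson_kernel_def using s ne
    by (intro continuous_intros) (auto intro: g')
  have c2: "continuous_on (sphere 0 \<bar>s\<bar> \<times> sphere 0 \<bar>r\<bar>) (\<lambda>(z, w). a / (cmod (w - z))\<^sup>2 * g w)"
    unfolding case_prod_unfold using s ne
    by (intro continuous_intros) (auto intro: g')
  show "circle_integrable s (\<lambda>z. circle_mean r (\<lambda>w. poisson_kernel z w * g w))"
    by (rule circle_mean_swap(2)[OF c1])
  show "circle_integrable s (\<lambda>z. circle_mean r (\<lambda>w. a / (cmod (w - z))\<^sup>2 * g w))"
    by (rule circle_mean_swap(2)[OF c2])
  have eq: "circle_mean s (\<lambda>z. a / (cmod (w - z))\<^sup>2 * g w) = a / (r\<^sup>2 - s\<^sup>2) * g w" if "cmod w = r" for a w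
    using circle_mean_cmult[of s "a * g w" "\<lambda>z. 1 / (cmod (w - z))\<^sup>2"]
      circle_mean_inverse_dist_square[of s r w] s that by (simp add: mult_ac)
  show "circle_mean s (\<lambda>z. circle_mean r (\<lambda>w. a / (cmod (w - z))\<^sup>2 * g w)) = a / (r\<^sup>2 - s\<^sup>2) * circle_mean r g"
    unfolding circle_mean_swap(1)[OF c2] circle_mean_cmult[symmetric]
    by (rule circle_mean_cong) (rule eq, use s in simp)
  have "circle_mean s (\<lambda>z. poisson_kernel z w * g w) = g w" if w: "cmod w = r" for w
  proof -
    have "circle_mean s (\<lambda>z. poisson_kernel z w * g w) = circle_mean s (\<lambda>z. (r\<^sup>2 - s\<^sup>2) / (cmod (w - z))\<^sup>2 * g w)"
      by (rule circle_mean_cong) (use s w in \<open>simp add: poisson_kernel_def\<close>)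
    also have "\<dots> = g w"
      using eq[OF w, of "r\<^sup>2 - s\<^sup>2"] s by (simp add: power_strict_mono less_imp_neq[symmetric])
    finally show ?thesis .
  qed
  then show "circle_mean s (\<lambda>z. circle_mean r (\<lambda>w. poisson_kernel z w * g w)) = circle_mean r g"
    unfolding circle_mean_swap(1)[OF c1]
    by (intro circle_mean_cong) (use s in simp)
qed

text \<open>The first term bounds an increase; the second bounds a decrease, by applying the same
  inequality to \<open>u + c\<close> and the shift \<open>-c\<close>.\<close>

lemma ln_cmod_add_diff_le:
  assumes "u \<noteq> 0" "u + c \<noteq> 0" "cmod c \<le> C"
  shows "\<bar>ln (cmod (u + c)) - ln (cmod u)\<bar> \<le> ln (1 + C / cmod u) + ln (1 + C / cmod (u + c))"
proof -
  have C: "C \<ge> 0" using assms(3) norm_ge_zero[of c] by linarith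
  have *: "ln (cmod (u + c)) \<le> ln (cmod u) + ln (1 + C / cmod u)"
    if "u \<noteq> 0" "u + c \<noteq> 0" "cmod c \<le> C" for u c
  proof -
    have "1 + C / cmod u > 0" using C by (intro add_pos_nonneg) auto
    then have "ln (cmod u) + ln (1 + C / cmod u) = ln (cmod u * (1 + C / cmod u))"
      using that by (simp add: ln_mult_pos)
    also have "cmod u * (1 + C / cmod u) = cmod u + C" using that by (simp add: field_simps)
    finally show ?thesis
      using that norm_triangle_ineq[of u c] by (simp add: ln_mono)
  qed
  have "0 \<le> ln (1 + C / cmod u)" "0 \<le> ln (1 + C / cmod (u + c))"
    using C by (auto intro!: ln_ge_zero)
  then show ?thesis
    using *[of u c] *[of "u + c" "-c"] assms by auto
qed

text \<open>Up to constants, \<open>green\<close> consists of the distances to \<open>a\<close> and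
  to its reflection \<open>b\<close>. Moving the shift into the centres \<open>a - c\<close> and
  \<open>b - c\<close> brings all four terms into the form of
  \<open>circle_mean_ln_one_plus\<close>.\<close>

lemma green_diff_le:
  assumes z: "cmod z < R" "cmod (z + c) < R" "z \<noteq> a" "z + c \<noteq> a" and a: "cmod a < R" and c: "cmod c \<le> C"
  defines "b \<equiv> of_real (R\<^sup>2) / cnj a"
  shows "\<bar>green R z a - green R (z + c) a\<bar> \<le>
    ln (1 + C / cmod (z - a)) + ln (1 + C / cmod (z - (a - c))) +
    ln (1 + C / cmod (z - b)) + ln (1 + C / cmod (z - (b - c)))"
proof -
  have C: "C \<ge> 0" using c norm_ge_zero[of c] by linarith
  have 1: "\<bar>ln (cmod (z + c - a)) - ln (cmod (z - a))\<bar> \<le>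
      ln (1 + C / cmod (z - a)) + ln (1 + C / cmod (z - (a - c)))"
    using ln_cmod_add_diff_le[of "z - a" c C] z c by (simp add: algebra_simps)
  have 2: "\<bar>ln (cmod (of_real (R\<^sup>2) - cnj a * (z + c))) - ln (cmod (of_real (R\<^sup>2) - cnj a * z))\<bar> \<le>
      ln (1 + C / cmod (z - b)) + ln (1 + C / cmod (z - (b - c)))"
  proof (cases "a = 0")
    \<comment> \<open>The reflected factor is constant here, and \<open>b\<close> is 0 by the
      convention for division by zero; the right-hand side is just nonnegative.\<close>
    case True
    then show ?thesis using C by (auto intro!: add_nonneg_nonneg ln_ge_zero)
  next
    case False
    have eq: "cmod (of_real (R\<^sup>2) - cnj a * u) = cmod a * cmod (u - b)" for u
    proof -
      have "of_real (R\<^sup>2) - cnj a * u = - (cnj a * (u - b))" using False by (simp add: b_def algebra_simps)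
      then show ?thesis by (simp only: norm_minus_cancel norm_mult complex_mod_cnj)
    qed
    have nz: "u - b \<noteq> 0" if "cmod u < R" for u
      using reflect_nonzero[OF a, of u] that eq[of u] by auto
    have "ln (cmod (of_real (R\<^sup>2) - cnj a * u)) = ln (cmod a) + ln (cmod (u - b))" if "cmod u < R" for u
      unfolding eq using False nz[OF that] by (intro ln_mult_pos) auto
    moreover have "z - b + c = z + c - b" "z - (b - c) = z + c - b" by (simp_all add: algebra_simps)
    ultimately show ?thesis
      using z ln_cmod_add_diff_le[of "z - b" c C] nz[of z] nz[of "z + c"] c by (simp only:) simp
  qed
  show ?thesis using 1 2 unfolding green_def by linarith
qed

section \<open>The characteristic as a finite sum, and its monotonicity\<close>

context nonconstant_meromorphic
begin

text \<open>The negative part of the order; being 0 at zeros of \<open>f\<close>, it lets sums over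
  poles run over \<open>zeros\<close>.\<close>

definition pole_mult :: "complex \<Rightarrow> real" where
  "pole_mult a = max 0 (- of_int (zorder f a))"

lemma pole_mult_nonneg: "0 \<le> pole_mult a" by (simp add: pole_mult_def)

lemma pole_count_eq:
  assumes R: "generic R" and t: "t \<le> R"
  shows "pole_count t f = (\<Sum>a\<in>zeros R. if cmod a \<le> t then pole_mult a else 0)"
proof -
  have "(\<Sum>a\<in>zeros R. if cmod a \<le> t then pole_mult a else 0) =
        (\<Sum>a | cmod a \<le> t \<and> is_pole f a. if cmod a \<le> t then pole_mult a else 0)"
  proof (rule sum.mono_neutral_right)
    show "{a. cmod a \<le> t \<and> is_pole f a} \<subseteq> zeros R"
      using R t pole_imp_zero by (force simp: zeros_def generic_def)
    show "\<forall>a\<in>zeros R - {a. cmod a \<le> t \<and> is_pole f a}. (if cmod a \<le> t then pole_mult a else 0) = 0"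
      by (auto simp: pole_mult_def is_pole_iff_zorder)
  qed auto
  also have "\<dots> = pole_count t f"
    unfolding pole_count_def by (intro sum.cong) (auto simp: pole_mult_def is_pole_iff_zorder)
  finally show ?thesis by simp
qed

text \<open>A pole a other than 0 contributes the integral of 1/t from |a| to R. A pole at 0
  contributes ln R, which has the same form because ln 0 = 0.\<close>

lemma integrated_pole_count_eq:
  assumes R: "generic R" "R > 0"
  shows "integrated_pole_count R f = (\<Sum>a\<in>zeros R. pole_mult a * (ln R - ln (cmod a)))"
proof -
  define q where "q a t = indicator {cmod a..R} t *\<^sub>R (1 / t)" for a :: complex and t :: real
  have q: "integrable lborel (q a)" "integral\<^sup>L lborel (q a) = ln R - ln (cmod a)" if "a \<in> zeros R - {0}" for a
  proof -
    have a: "0 < cmod a" "cmod a \<le> R" using that by (auto simp: zeros_def)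
    have c: "continuous_on {cmod a..R} (\<lambda>t. 1 / t)" using a by (auto intro!: continuous_intros)
    show "integrable lborel (q a)"
      unfolding q_def by (rule borel_integrable_compact[OF compact_Icc c])
    show "integral\<^sup>L lborel (q a) = ln R - ln (cmod a)"
      unfolding q_def
    proof (rule integral_FTC_atLeastAtMost[OF a(2) _ c])
      fix x assume "cmod a \<le> x" "x \<le> R"
      then have "0 < x" using a(1) by linarith
      then show "(ln has_vector_derivative 1 / x) (at x within {cmod a..R})"
        by (auto intro!: derivative_eq_intros simp flip: has_real_derivative_iff_has_vector_derivative)
    qed
  qed
  have p0: "pole_count 0 f = pole_mult 0"
  proof -
    have "pole_count 0 f = (\<Sum>a\<in>zeros R. if a = 0 then pole_mult a else 0)"
      using pole_count_eq[OF R(1), of 0] R by simp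
    also have "\<dots> = (if 0 \<in> zeros R then pole_mult 0 else 0)"
      by simp
    finally show ?thesis
      using R(2) by (auto simp: zeros_def zorder_nonzero pole_mult_def)
  qed
  have "(LINT t:{0<..R}|lborel. (pole_count t f - pole_count 0 f) / t) =
        integral\<^sup>L lborel (\<lambda>t. \<Sum>a\<in>zeros R - {0}. pole_mult a * q a t)"
    unfolding set_lebesgue_integral_def
  proof (rule Bochner_Integration.integral_cong[OF refl])
    fix t :: real
    show "indicator {0<..R} t *\<^sub>R ((pole_count t f - pole_count 0 f) / t) = (\<Sum>a\<in>zeros R - {0}. pole_mult a * q a t)"
    proof (cases "0 < t \<and> t \<le> R")
      case True
      have "pole_count t f - pole_count 0 f =
         (\<Sum>a\<in>zeros R. if cmod a \<le> t then pole_mult a else 0) - (\<Sum>a\<in>zeros R. if cmod a \<le> 0 then pole_mult a else 0)"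
        using R True by (simp only: pole_count_eq[OF R(1)] less_imp_le)
      also have "\<dots> = (\<Sum>a\<in>zeros R. (if cmod a \<le> t then pole_mult a else 0) - (if cmod a \<le> 0 then pole_mult a else 0))"
        by (simp only: sum_subtractf)
      also have "\<dots> = (\<Sum>a\<in>zeros R - {0}. if cmod a \<le> t then pole_mult a else 0)"
        by (rule sum.mono_neutral_cong_right) (use True in auto)
      finally have "(pole_count t f - pole_count 0 f) / t =
          (\<Sum>a\<in>zeros R - {0}. (if cmod a \<le> t then pole_mult a else 0) / t)"
        by (simp only: sum_divide_distrib)
      also have "\<dots> = (\<Sum>a\<in>zeros R - {0}. pole_mult a * q a t)"
        by (intro sum.cong) (use True in \<open>simp_all add: q_def\<close>)
      finally have "(pole_count t f - pole_count 0 f) / t = (\<Sum>a\<in>zeros R - {0}. pole_mult a * q a t)" .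
      then show ?thesis using True by simp
    next
      case False
      then have "q a t = 0" if "a \<noteq> 0" for a
        using that zero_less_norm_iff[of a] by (auto simp: q_def indicator_def simp del: zero_less_norm_iff)
      then show ?thesis using False by auto
    qed
  qed
  also have "\<dots> = (\<Sum>a\<in>zeros R - {0}. pole_mult a * (ln R - ln (cmod a)))"
    using q by (subst Bochner_Integration.integral_sum) auto
  finally have "integrated_pole_count R f =
      (\<Sum>a\<in>zeros R - {0}. pole_mult a * (ln R - ln (cmod a))) + pole_mult 0 * ln R"
    by (simp add: integrated_pole_count_def p0)
  also have "\<dots> = (\<Sum>a\<in>zeros R. pole_mult a * (ln R - ln (cmod a)))"
  proof (cases "0 \<in> zeros R")
    case True
    then show ?thesis by (subst (2) sum.remove[of _ 0]) auto
  next
    case False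
    then show ?thesis using R by (simp add: zeros_def pole_mult_def zorder_nonzero)
  qed
  finally show ?thesis .
qed

lemma characteristic_eq:
  assumes R: "generic R" "R > 0"
  shows "characteristic R f = circle_mean R (\<lambda>w. max 0 (ln (cmod (f w)))) +
           (\<Sum>a\<in>zeros R. pole_mult a * (ln R - ln (cmod a)))"
proof -
  have "proximity R f = circle_mean R (\<lambda>w. log_plus (cmod (f w)))"
    by (simp add: proximity_def circle_mean_def)
  also have "\<dots> = circle_mean R (\<lambda>w. max 0 (ln (cmod (f w))))"
    by (rule circle_mean_cong) (use R in \<open>auto simp: log_plus_def generic_def\<close>)
  finally show ?thesis
    using integrated_pole_count_eq[OF R] by (simp add: characteristic_def)
qed

text \<open>For a = 0 the term is ln R, hence the hypothesis on R.\<close>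

lemma ln_minus_ln_cmod_nonneg:
  assumes "R \<ge> 1" "a \<in> zeros R"
  shows "0 \<le> ln R - ln (cmod a)"
  using assms by (cases "a = 0") (auto simp: zeros_def)

lemma characteristic_nonneg:
  assumes "generic R" "R \<ge> 1"
  shows "0 \<le> characteristic R f"
  using assms
  by (subst characteristic_eq)
     (auto intro!: add_nonneg_nonneg circle_mean_nonneg sum_nonneg mult_nonneg_nonneg pole_mult_nonneg ln_minus_ln_cmod_nonneg)

text \<open>Both the Poisson kernel and Green's function are nonnegative, so dropping the negative
  part of ln |f| on the circle and the contribution of the zeros only enlarges the right-hand side
  of Poisson-Jensen.\<close>

lemma ln_plus_le:
  assumes R: "generic R" and z: "cmod z < R" and fz: "f z \<noteq> 0"
  shows "max 0 (ln (cmod (f z))) \<le> circle_mean R (\<lambda>w. poisson_kernel z w * max 0 (ln (cmod (f w)))) +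
            (\<Sum>a\<in>zeros R. pole_mult a * green R z a)"
proof -
  have R0: "R > 0" using z norm_ge_zero[of z] by linarith
  have g: "0 \<le> green R z a" if "a \<in> zeros R" for a
    using that z fz by (intro green_nonneg) (auto simp: zeros_def)
  have P: "0 \<le> poisson_kernel z w" if "cmod w = R" for w using that z by (intro poisson_kernel_nonneg) auto
  have "circle_mean R (\<lambda>w. poisson_kernel z w * ln (cmod (f w))) \<le>
        circle_mean R (\<lambda>w. poisson_kernel z w * max 0 (ln (cmod (f w))))"
  proof (rule circle_mean_mono')
    show "circle_integrable R (\<lambda>w. poisson_kernel z w * ln (cmod (f w)))"
      "circle_integrable R (\<lambda>w. poisson_kernel z w * max 0 (ln (cmod (f w))))"
      using R0 z continuous_on_ln_f[OF R] by (auto intro!: circle_integrable_continuous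
          continuous_on_mult continuous_on_max continuous_on_const continuous_on_poisson_kernel)
  qed (use P R0 in \<open>auto intro: mult_left_mono\<close>)
  moreover have "(\<Sum>a\<in>zeros R. pole_mult a * green R z a) \<ge> (\<Sum>a\<in>zeros R. - (zorder f a * green R z a))"
  proof (rule sum_mono)
    fix a assume "a \<in> zeros R"
    then show "- (zorder f a * green R z a) \<le> pole_mult a * green R z a"
      using g[of a] mult_right_mono[of "- of_int (zorder f a)" "pole_mult a" "green R z a"] by (simp add: pole_mult_def)
  qed
  moreover have "0 \<le> circle_mean R (\<lambda>w. poisson_kernel z w * max 0 (ln (cmod (f w))))"
    using R0 P by (intro circle_mean_nonneg) auto
  moreover have "0 \<le> (\<Sum>a\<in>zeros R. pole_mult a * green R z a)"
    using g pole_mult_nonneg by (intro sum_nonneg) auto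
  ultimately show ?thesis
    using poisson_jensen[OF R z fz] by (simp add: sum_negf)
qed

text \<open>Average \<open>ln_plus_le\<close> over |z| = s. The Poisson means reproduce the
  proximity term at r, and the mean ln r - ln (max s |a|) of Green's function is exactly the
  increment of the counting term of a.\<close>

lemma characteristic_mono:
  assumes s: "generic s" "0 < s" and r: "generic r" "s < r"
  shows "characteristic s f \<le> characteristic r f"
proof -
  define m where "m w = max 0 (ln (cmod (f w)))" for w
  have r0: "r > 0" using s r by simp
  have mc: "continuous_on (sphere 0 s) m" "continuous_on (sphere 0 r) m"
    unfolding m_def using s r by (auto intro!: continuous_intros continuous_on_ln_f)
  have sa: "cmod a < r" "cmod a \<noteq> s" if "a \<in> zeros r" for a
    using that s by (auto simp: zeros_def generic_def)
  have gi: "circle_integrable s (\<lambda>z. pole_mult a * green r z a)" if "a \<in> zeros r" for a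
    using sa[OF that] s r
    by (intro circle_integrable_continuous continuous_intros continuous_on_green) auto
  note pi = circle_mean_poisson_kernel_swap(2)[OF s(2) r(2) mc(2)]
  note gsum = circle_integrable_sum[OF gi, of "zeros r" "\<lambda>a. a", simplified]
  have "circle_mean s m \<le> circle_mean s (\<lambda>z. circle_mean r (\<lambda>w. poisson_kernel z w * m w) +
            (\<Sum>a\<in>zeros r. pole_mult a * green r z a))"
  proof (rule circle_mean_mono')
    show "circle_integrable s m" using mc s by (intro circle_integrable_continuous) auto
    show "circle_integrable s (\<lambda>z. circle_mean r (\<lambda>w. poisson_kernel z w * m w) +
            (\<Sum>a\<in>zeros r. pole_mult a * green r z a))"
      by (rule set_integral_add(1)[OF pi gsum])
    show "m z \<le> circle_mean r (\<lambda>w. poisson_kernel z w * m w) + (\<Sum>a\<in>zeros r. pole_mult a * green r z a)"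
      if "cmod z = \<bar>s\<bar>" for z
      unfolding m_def using that s r by (intro ln_plus_le) (auto simp: generic_def)
  qed
  also have "\<dots> = circle_mean r m + (\<Sum>a\<in>zeros r. pole_mult a * (ln r - ln (max s (cmod a))))"
    using circle_mean_add[OF pi gsum] circle_mean_sum[OF gi, of "zeros r" "\<lambda>a. a"] sa
      circle_mean_poisson_kernel_swap(1)[OF s(2) r(2) mc(2)] circle_mean_green[OF s(2) r(2)]
    by (simp add: circle_mean_cmult)
  finally have 1: "circle_mean s m \<le> circle_mean r m + (\<Sum>a\<in>zeros r. pole_mult a * (ln r - ln (max s (cmod a))))" .
  have "(\<Sum>a\<in>zeros s. pole_mult a * (ln s - ln (cmod a))) =
        (\<Sum>a\<in>zeros r. if cmod a < s then pole_mult a * (ln s - ln (cmod a)) else 0)"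
    by (rule sum.mono_neutral_cong_left[OF finite_zeros_ball]) (use r in \<open>auto simp: zeros_def\<close>)
  then have "(\<Sum>a\<in>zeros r. pole_mult a * (ln r - ln (max s (cmod a)))) +
        (\<Sum>a\<in>zeros s. pole_mult a * (ln s - ln (cmod a))) =
        (\<Sum>a\<in>zeros r. pole_mult a * (ln r - ln (max s (cmod a))) + (if cmod a < s then pole_mult a * (ln s - ln (cmod a)) else 0))"
    by (simp add: sum.distrib)
  also have "\<dots> = (\<Sum>a\<in>zeros r. pole_mult a * (ln r - ln (cmod a)))"
    by (intro sum.cong) (use sa in \<open>auto simp: max_def algebra_simps\<close>)
  finally show ?thesis
    using 1 characteristic_eq[OF s] characteristic_eq[OF r(1) r0] by (simp add: m_def[abs_def])
qed

end

section \<open>Growth of the characteristic and the shift quotient\<close>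

context nonconstant_meromorphic
begin

lemma countable_not_generic: "countable {r. \<not> generic r}"
proof -
  have "{r. \<not> generic r} \<subseteq> (\<Union>n. cmod ` {z. f z = 0 \<and> cmod z \<le> real n})"
  proof
    fix r assume "r \<in> {r. \<not> generic r}"
    then obtain z where z: "cmod z = r" "f z = 0" by (auto simp: generic_def)
    moreover obtain n where "cmod z \<le> real n" using real_arch_simple by blast
    ultimately show "r \<in> (\<Union>n. cmod ` {z. f z = 0 \<and> cmod z \<le> real n})" by blast
  qed
  moreover have "countable (\<Union>n. cmod ` {z. f z = 0 \<and> cmod z \<le> real n})"
    by (rule countable_UN[OF countableI_type]) (intro countable_image countable_finite finite_zeros)
  ultimately show ?thesis by (rule countable_subset)
qed

lemma generic_between:
  assumes "a < b"
  obtains r where "a < r" "r < b" "generic r"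
proof -
  have "\<not> {a<..<b} \<subseteq> {r. \<not> generic r}"
    using countable_not_generic uncountable_open_interval[of a b] assms countable_subset by blast
  then show ?thesis using that by auto
qed

text \<open>If \<open>T\<close> vanished at all large radii, then \<open>f\<close> would have no poles and, by the Poisson-Jensen formula,
  modulus at most \<open>1\<close>.\<close>

lemma characteristic_pos:
  obtains r \<delta> where "1 \<le> r" "0 < \<delta>" "\<And>s. generic s \<Longrightarrow> r \<le> s \<Longrightarrow> \<delta> \<le> characteristic s f"
proof -
  have "\<exists>r\<ge>1. generic r \<and> characteristic r f > 0"
  proof (rule ccontr)
    assume "\<not> ?thesis"
    then have T0: "characteristic r f = 0" if "generic r" "r \<ge> 1" for r
      using characteristic_nonneg[OF that] that by force
    have terms: "circle_mean r (\<lambda>w. max 0 (ln (cmod (f w)))) = 0"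
      "(\<Sum>a\<in>zeros r. pole_mult a * (ln r - ln (cmod a))) = 0" if "generic r" "r \<ge> 1" for r
    proof -
      have "0 \<le> circle_mean r (\<lambda>w. max 0 (ln (cmod (f w))))" by (intro circle_mean_nonneg) auto
      moreover have "0 \<le> (\<Sum>a\<in>zeros r. pole_mult a * (ln r - ln (cmod a)))"
        using that by (intro sum_nonneg mult_nonneg_nonneg pole_mult_nonneg ln_minus_ln_cmod_nonneg)
      ultimately show "circle_mean r (\<lambda>w. max 0 (ln (cmod (f w)))) = 0"
        "(\<Sum>a\<in>zeros r. pole_mult a * (ln r - ln (cmod a))) = 0"
        using T0[OF that] characteristic_eq[of r] that by auto
    qed
    have pm: "pole_mult b = 0" if fb: "f b = 0" for b
    proof -
      obtain r where r: "max 1 (cmod b) < r" "r < max 1 (cmod b) + 1" "generic r"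
        using generic_between[of "max 1 (cmod b)" "max 1 (cmod b) + 1"] by auto
      have b: "b \<in> zeros r" using r fb by (simp add: zeros_def)
      have "\<forall>a\<in>zeros r. pole_mult a * (ln r - ln (cmod a)) = 0"
        using terms(2)[OF r(3)] r
        by (subst sum_nonneg_eq_0_iff[symmetric]) (auto intro!: mult_nonneg_nonneg pole_mult_nonneg ln_minus_ln_cmod_nonneg)
      \<comment> \<open>For b = 0 this is ln r, which is positive since r > 1.\<close>
      moreover have "ln r - ln (cmod b) \<noteq> 0"
        using r ln_less_cancel_iff[of "cmod b" r] by (cases "b = 0") auto
      ultimately show ?thesis using b by auto
    qed
    have nopole: "\<not> is_pole f b" for b
      using pm[of b] pole_imp_zero[of b] by (auto simp: is_pole_iff_zorder pole_mult_def)
    have bound: "cmod (f z) \<le> 1" for z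
    proof (cases "f z = 0")
      case False
      obtain r where r: "cmod z + 1 < r" "r < cmod z + 2" "generic r"
        using generic_between[of "cmod z + 1" "cmod z + 2"] by auto
      have zr: "cmod z < r" and r1: "r \<ge> 1" using r norm_ge_zero[of z] by linarith+
      define m where "m w = max 0 (ln (cmod (f w)))" for w
      have mc: "continuous_on (sphere 0 \<bar>r\<bar>) m"
        unfolding m_def using r1 r by (auto intro!: continuous_on_max continuous_on_ln_f)
      \<comment> \<open>The radius exceeds |z| + 1, so |w - z| >= 1 and the kernel is at most its
        numerator.\<close>
      define B where "B = r\<^sup>2"
      have "circle_mean r (\<lambda>w. poisson_kernel z w * m w) \<le> circle_mean r (\<lambda>w. B * m w)"
      proof (rule circle_mean_mono)
        show "circle_integrable r (\<lambda>w. B * m w)"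
          by (intro circle_integrable_continuous continuous_intros mc)
        fix w assume w: "cmod w = \<bar>r\<bar>"
        have "cmod (w - z) \<ge> 1" using norm_triangle_ineq2[of w z] w r r1 by simp
        then have "1 \<le> (cmod (w - z))\<^sup>2" by simp
        then have "poisson_kernel z w \<le> ((cmod w)\<^sup>2 - (cmod z)\<^sup>2) / 1"
          unfolding poisson_kernel_def using w zr by (intro divide_left_mono) (auto intro: power_mono)
        also have "\<dots> \<le> B" using w by (simp add: B_def)
        finally show "poisson_kernel z w * m w \<le> B * m w" by (intro mult_right_mono) (auto simp: m_def)
        show "0 \<le> B * m w" by (simp add: B_def m_def)
      qed
      also have "\<dots> = 0"
        using terms(1)[OF r(3) r1] by (simp add: circle_mean_cmult m_def[abs_def])
      finally have "circle_mean r (\<lambda>w. poisson_kernel z w * m w) \<le> 0" .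
      moreover have "(\<Sum>a\<in>zeros r. pole_mult a * green r z a) = 0"
        by (rule sum.neutral) (auto simp: zeros_def pm)
      ultimately have "max 0 (ln (cmod (f z))) \<le> 0"
        using ln_plus_le[OF r(3) zr False] by (simp add: m_def[abs_def])
      then show ?thesis using False by simp
    qed simp
    have "f holomorphic_on UNIV"
      using nicely_meromorphic_without_singularities[OF mero] nopole analytic_imp_holomorphic by blast
    moreover have "bounded (range f)" using bound by (auto simp: bounded_iff)
    ultimately show False using Liouville_theorem nonconst by blast
  qed
  then obtain r where r: "r \<ge> 1" "generic r" "characteristic r f > 0" by blast
  show ?thesis
  proof
    show "characteristic r f \<le> characteristic s f" if "generic s" "r \<le> s" for s
      using characteristic_mono[of r s] r that by (cases "s = r") auto
  qed (use r in auto)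
qed

text \<open>The first main theorem, with \<open>T(r, f)\<close> and \<open>T(r, 1/f)\<close> added up.\<close>

lemma first_main_theorem:
  assumes R: "generic R" "R > 0"
  shows "circle_mean R (\<lambda>w. \<bar>ln (cmod (f w))\<bar>) + (\<Sum>a\<in>zeros R. \<bar>real_of_int (zorder f a)\<bar> * (ln R - ln (cmod a))) =
           2 * characteristic R f - ln (cmod (zor_poly f 0 0))"
proof -
  have c: "continuous_on (sphere 0 \<bar>R\<bar>) (\<lambda>w. ln (cmod (f w)))"
    using R by (auto intro: continuous_on_ln_f)
  have i: "circle_integrable R (\<lambda>w. 2 * max 0 (ln (cmod (f w))))" "circle_integrable R (\<lambda>w. -1 * ln (cmod (f w)))"
    by (intro circle_integrable_continuous continuous_intros c)+
  have "circle_mean R (\<lambda>w. \<bar>ln (cmod (f w))\<bar>) = circle_mean R (\<lambda>w. 2 * max 0 (ln (cmod (f w))) + -1 * ln (cmod (f w)))"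
    by (rule circle_mean_cong) auto
  also have "\<dots> = 2 * circle_mean R (\<lambda>w. max 0 (ln (cmod (f w)))) - circle_mean R (\<lambda>w. ln (cmod (f w)))"
    unfolding circle_mean_add[OF i] circle_mean_cmult by simp
  finally have 1: "circle_mean R (\<lambda>w. \<bar>ln (cmod (f w))\<bar>) =
      2 * circle_mean R (\<lambda>w. max 0 (ln (cmod (f w)))) - circle_mean R (\<lambda>w. ln (cmod (f w)))" .
  have "\<bar>real_of_int (zorder f a)\<bar> = zorder f a + 2 * pole_mult a" for a
    by (simp add: pole_mult_def)
  then have "(\<Sum>a\<in>zeros R. \<bar>real_of_int (zorder f a)\<bar> * (ln R - ln (cmod a))) =
     (\<Sum>a\<in>zeros R. zorder f a * (ln R - ln (cmod a))) + 2 * (\<Sum>a\<in>zeros R. pole_mult a * (ln R - ln (cmod a)))"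
    by (simp add: distrib_right sum.distrib sum_distrib_left mult.assoc)
  then show ?thesis
    using 1 jensen[OF R] characteristic_eq[OF R] by simp
qed

lemma characteristic_bounds:
  assumes R: "generic R" "R \<ge> 1"
  shows "circle_mean R (\<lambda>w. \<bar>ln (cmod (f w))\<bar>) \<le> 2 * characteristic R f + \<bar>ln (cmod (zor_poly f 0 0))\<bar>"
    and "(\<Sum>a\<in>zeros R. \<bar>real_of_int (zorder f a)\<bar> * (ln R - ln (cmod a))) \<le> 2 * characteristic R f + \<bar>ln (cmod (zor_poly f 0 0))\<bar>"
proof -
  have "0 \<le> circle_mean R (\<lambda>w. \<bar>ln (cmod (f w))\<bar>)" by (intro circle_mean_nonneg) auto
  moreover have "0 \<le> (\<Sum>a\<in>zeros R. \<bar>real_of_int (zorder f a)\<bar> * (ln R - ln (cmod a)))"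
    using R by (intro sum_nonneg mult_nonneg_nonneg ln_minus_ln_cmod_nonneg) auto
  ultimately show "circle_mean R (\<lambda>w. \<bar>ln (cmod (f w))\<bar>) \<le> 2 * characteristic R f + \<bar>ln (cmod (zor_poly f 0 0))\<bar>"
    and "(\<Sum>a\<in>zeros R. \<bar>real_of_int (zorder f a)\<bar> * (ln R - ln (cmod a))) \<le> 2 * characteristic R f + \<bar>ln (cmod (zor_poly f 0 0))\<bar>"
    using first_main_theorem[of R] R by auto
qed

text \<open>Each point of the smaller disc has weight at least ln (R' / R) >= (R' - R) / R' in the
  weighted count for \<open>R'\<close>, which the first main theorem bounds.\<close>

lemma count_zeros_le:
  assumes R: "1 \<le> R" "R < R'" and gen: "generic R'"
  shows "(\<Sum>a\<in>zeros R. \<bar>real_of_int (zorder f a)\<bar>) \<le>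
           R' / (R' - R) * (2 * characteristic R' f + \<bar>ln (cmod (zor_poly f 0 0))\<bar>)"
proof -
  have "1 - R / R' \<le> ln (R' / R)"
    using ln_le_minus_one[of "R / R'"] R by (simp add: ln_div)
  then have q: "(R' - R) / R' \<le> ln R' - ln R" using R by (simp add: ln_div diff_divide_distrib)
  have "(R' - R) / R' * (\<Sum>a\<in>zeros R. \<bar>real_of_int (zorder f a)\<bar>) =
        (\<Sum>a\<in>zeros R. \<bar>real_of_int (zorder f a)\<bar> * ((R' - R) / R'))"
    by (simp only: sum_distrib_left mult.commute)
  also have "\<dots> \<le> (\<Sum>a\<in>zeros R. \<bar>real_of_int (zorder f a)\<bar> * (ln R' - ln (cmod a)))"
  proof (intro sum_mono mult_left_mono)
    fix a assume a: "a \<in> zeros R"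
    have "ln (cmod a) \<le> ln R" using a R by (cases "a = 0") (auto simp: zeros_def)
    then show "(R' - R) / R' \<le> ln R' - ln (cmod a)" using q by linarith
  qed auto
  also have "\<dots> \<le> (\<Sum>a\<in>zeros R'. \<bar>real_of_int (zorder f a)\<bar> * (ln R' - ln (cmod a)))"
    using R by (intro sum_mono2 finite_zeros_ball mult_nonneg_nonneg ln_minus_ln_cmod_nonneg) (auto simp: zeros_def)
  also have "\<dots> \<le> 2 * characteristic R' f + \<bar>ln (cmod (zor_poly f 0 0))\<bar>"
    using R gen by (intro characteristic_bounds) auto
  finally show ?thesis using R by (simp add: field_simps)
qed

text \<open>Absolute values are taken inside the mean and the sum, so cancellation between zeros and
  poles is given up; the first main theorem controls exactly these absolute quantities.\<close>

lemma ln_shift_quotient_le: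
  assumes R: "generic R" and z: "cmod z < R" and c: "2 * cmod c \<le> R - cmod z" "cmod c \<le> C"
    and nz: "f z \<noteq> 0" "f (z + c) \<noteq> 0"
  defines "b \<equiv> (\<lambda>a. of_real (R\<^sup>2) / cnj a)"
  shows "ln (cmod (f (z + c))) - ln (cmod (f z)) \<le>
     circle_mean R (\<lambda>w. 4 * C * R / (cmod (w - z))\<^sup>2 * \<bar>ln (cmod (f w))\<bar>) +
     (\<Sum>a\<in>zeros R. \<bar>real_of_int (zorder f a)\<bar> *
        (ln (1 + C / cmod (z - a)) + ln (1 + C / cmod (z - (a - c))) +
         ln (1 + C / cmod (z - b a)) + ln (1 + C / cmod (z - (b a - c)))))"
proof -
  have R0: "R > 0" using z norm_ge_zero[of z] by linarith
  have zc: "cmod (z + c) < R"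
    using norm_triangle_ineq[of z c] c z by linarith
  define l where "l w = ln (cmod (f w))" for w
  have lc: "continuous_on (sphere 0 \<bar>R\<bar>) l"
    unfolding l_def using R R0 by (auto intro: continuous_on_ln_f)
  have wz: "w \<noteq> z" if "cmod w = R" for w using that z by auto
  have pint: "circle_integrable R (\<lambda>w. poisson_kernel u w * l w)" if "cmod u < R" for u
    using R0 that lc by (auto intro!: circle_integrable_continuous continuous_on_mult continuous_on_poisson_kernel)
  have pint2: "circle_integrable R (\<lambda>w. 4 * C * R / (cmod (w - z))\<^sup>2 * \<bar>l w\<bar>)"
    using R0 lc wz by (intro circle_integrable_continuous continuous_intros) auto
  have "circle_mean R (\<lambda>w. poisson_kernel (z + c) w * l w) \<le>
        circle_mean R (\<lambda>w. poisson_kernel z w * l w + 4 * C * R / (cmod (w - z))\<^sup>2 * \<bar>l w\<bar>)"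
  proof (rule circle_mean_mono'[OF pint[OF zc] set_integral_add(1)[OF pint[OF z] pint2]])
    fix w assume "cmod w = \<bar>R\<bar>"
    then have w: "cmod w = R" using R0 by simp
    have "(poisson_kernel (z + c) w - poisson_kernel z w) * l w \<le> \<bar>poisson_kernel (z + c) w - poisson_kernel z w\<bar> * \<bar>l w\<bar>"
      by (metis abs_ge_self abs_mult)
    also have "\<dots> \<le> 4 * cmod c * R / (cmod (w - z))\<^sup>2 * \<bar>l w\<bar>"
      using poisson_kernel_diff_le[OF w z c(1)] by (intro mult_right_mono) auto
    also have "\<dots> \<le> 4 * C * R / (cmod (w - z))\<^sup>2 * \<bar>l w\<bar>"
      using c(2) R0 by (intro mult_right_mono divide_right_mono) auto
    finally show "poisson_kernel (z + c) w * l w \<le> poisson_kernel z w * l w + 4 * C * R / (cmod (w - z))\<^sup>2 * \<bar>l w\<bar>"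
      by (simp add: algebra_simps)
  qed
  also have "\<dots> = circle_mean R (\<lambda>w. poisson_kernel z w * l w) + circle_mean R (\<lambda>w. 4 * C * R / (cmod (w - z))\<^sup>2 * \<bar>l w\<bar>)"
    by (rule circle_mean_add[OF pint[OF z] pint2])
  finally have 1: "circle_mean R (\<lambda>w. poisson_kernel (z + c) w * l w) \<le>
     circle_mean R (\<lambda>w. poisson_kernel z w * l w) + circle_mean R (\<lambda>w. 4 * C * R / (cmod (w - z))\<^sup>2 * \<bar>l w\<bar>)" .
  have "(\<Sum>a\<in>zeros R. zorder f a * green R z a) - (\<Sum>a\<in>zeros R. zorder f a * green R (z + c) a) =
        (\<Sum>a\<in>zeros R. zorder f a * (green R z a - green R (z + c) a))"
    by (simp add: right_diff_distrib sum_subtractf)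
  also have "\<dots> \<le> (\<Sum>a\<in>zeros R. \<bar>real_of_int (zorder f a)\<bar> *
        (ln (1 + C / cmod (z - a)) + ln (1 + C / cmod (z - (a - c))) +
         ln (1 + C / cmod (z - b a)) + ln (1 + C / cmod (z - (b a - c)))))"
  proof (rule sum_mono)
    fix a assume a: "a \<in> zeros R"
    have "zorder f a * (green R z a - green R (z + c) a) \<le> \<bar>real_of_int (zorder f a)\<bar> * \<bar>green R z a - green R (z + c) a\<bar>"
      by (metis abs_ge_self abs_mult)
    also have "\<dots> \<le> \<bar>real_of_int (zorder f a)\<bar> *
        (ln (1 + C / cmod (z - a)) + ln (1 + C / cmod (z - (a - c))) +
         ln (1 + C / cmod (z - b a)) + ln (1 + C / cmod (z - (b a - c))))"
      unfolding b_def using a nz z zc c(2)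
      by (intro mult_left_mono green_diff_le) (auto simp: zeros_def)
    finally show "zorder f a * (green R z a - green R (z + c) a) \<le> \<bar>real_of_int (zorder f a)\<bar> *
        (ln (1 + C / cmod (z - a)) + ln (1 + C / cmod (z - (a - c))) +
         ln (1 + C / cmod (z - b a)) + ln (1 + C / cmod (z - (b a - c))))" .
  qed
  finally show ?thesis
    using 1 poisson_jensen[OF R z nz(1)] poisson_jensen[OF R zc nz(2)] by (simp add: l_def)
qed

text \<open>The first summand uses R / (R^2 - r^2) <= 1 / (R - r). In the second, 128 = 4 * 32
  counts the four logarithmic kernels per point, and \<open>R'\<close> enters through
  \<open>count_zeros_le\<close>.\<close>

lemma proximity_shift_quotient_le:
  assumes C: "1 \<le> C" "cmod c \<le> C" and r: "3 \<le> r" "2 * cmod c \<le> R - r" "r < R" "R < R'"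
    and gen: "generic R" "generic R'"
  shows "proximity r (\<lambda>z. f (z + c) / f z) \<le>
    (4 * C / (R - r) + 128 * C * ln r / r * (R' / (R' - R))) *
    (2 * characteristic R' f + \<bar>ln (cmod (zor_poly f 0 0))\<bar>)"
proof -
  define T where "T = 2 * characteristic R' f + \<bar>ln (cmod (zor_poly f 0 0))\<bar>"
  define l where "l w = \<bar>ln (cmod (f w))\<bar>" for w
  define L where "L b z = ln (1 + C / cmod (z - b))" for b z
  define n where "n a = \<bar>real_of_int (zorder f a)\<bar>" for a
  define b where "b a = of_real (R\<^sup>2) / cnj a" for a
  define U where "U z = circle_mean R (\<lambda>w. 4 * C * R / (cmod (w - z))\<^sup>2 * l w)" for z
  define V where "V a z = n a * (L a z + L (a - c) z + L (b a) z + L (b a - c) z)" for a z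
  have r0: "r > 0" "R > 0" "R \<ge> 1" "R' \<ge> 1" using r by auto
  have T0: "0 \<le> T" unfolding T_def using characteristic_nonneg[OF gen(2)] r0 by simp
  have lc: "continuous_on (sphere 0 R) l"
    unfolding l_def by (intro continuous_intros continuous_on_ln_f gen)
  have L0: "0 \<le> L b z" for b z unfolding L_def using C by (intro ln_ge_zero) auto
  have V0: "0 \<le> V a z" for a z unfolding V_def n_def using L0 by (intro mult_nonneg_nonneg add_nonneg_nonneg) auto
  have U0: "0 \<le> U z" for z unfolding U_def using C r0 by (intro circle_mean_nonneg) (auto simp: l_def)
  note Lint = circle_mean_ln_one_plus(1)[OF C(1) r(1), folded L_def]
  note Lle = circle_mean_ln_one_plus(2)[OF C(1) r(1), folded L_def]
  note Ladd1 = set_integral_add(1)[OF Lint Lint]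
  note Ladd2 = set_integral_add(1)[OF Ladd1 Lint]
  note Ladd3 = set_integral_add(1)[OF Ladd2 Lint]
  have Vint: "circle_integrable r (V a)" for a
    unfolding V_def using Ladd3 by (intro set_integrable_mult_right) auto
  have Vle: "circle_mean r (V a) \<le> n a * (128 * C * ln r / r)" for a
  proof -
    have "circle_mean r (V a) = n a * (circle_mean r (L a) + circle_mean r (L (a - c)) + circle_mean r (L (b a)) + circle_mean r (L (b a - c)))"
      unfolding V_def circle_mean_cmult
      by (simp add: circle_mean_add[OF Ladd2 Lint] circle_mean_add[OF Ladd1 Lint] circle_mean_add[OF Lint Lint])
    also have "\<dots> \<le> n a * (32 * C * ln r / r + 32 * C * ln r / r + 32 * C * ln r / r + 32 * C * ln r / r)"
      by (intro mult_left_mono add_mono Lle) (auto simp: n_def)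
    finally show ?thesis by simp
  qed
  have Uint: "circle_integrable r U"
    unfolding U_def by (rule circle_mean_poisson_kernel_swap(4)[OF r0(1) r(3) lc])
  have Sint: "circle_integrable r (\<lambda>z. \<Sum>a\<in>zeros R. V a z)"
    by (rule circle_integrable_sum[OF Vint])
  have "proximity r (\<lambda>z. f (z + c) / f z) = circle_mean r (\<lambda>z. log_plus (cmod (f (z + c) / f z)))"
    by (simp add: proximity_def circle_mean_def)
  also have "\<dots> \<le> circle_mean r (\<lambda>z. U z + (\<Sum>a\<in>zeros R. V a z))"
  proof (rule circle_mean_mono[OF set_integral_add(1)[OF Uint Sint]])
    fix z assume "cmod z = \<bar>r\<bar>"
    then have z: "cmod z = r" using r0 by simp
    show nn: "0 \<le> U z + (\<Sum>a\<in>zeros R. V a z)"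
      using U0 V0 by (intro add_nonneg_nonneg sum_nonneg) auto
    show "log_plus (cmod (f (z + c) / f z)) \<le> U z + (\<Sum>a\<in>zeros R. V a z)"
    proof (cases "f z = 0 \<or> f (z + c) = 0")
      \<comment> \<open>At zeros and poles of either function the total quotient is 0, so the
        left-hand side is 0.\<close>
      case True
      then show ?thesis using nn by (auto simp: log_plus_def)
    next
      case False
      then have "ln (cmod (f (z + c))) - ln (cmod (f z)) \<le> U z + (\<Sum>a\<in>zeros R. V a z)"
        unfolding U_def V_def L_def l_def n_def b_def using z r C gen
        by (intro ln_shift_quotient_le) auto
      then show ?thesis using nn False by (simp add: log_plus_def norm_divide ln_div)
    qed
  qed
  also have "\<dots> = circle_mean r U + (\<Sum>a\<in>zeros R. circle_mean r (V a))"
    by (simp add: circle_mean_add[OF Uint Sint] circle_mean_sum[OF Vint])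
  also have "\<dots> \<le> 4 * C / (R - r) * T + 128 * C * ln r / r * (R' / (R' - R)) * T"
  proof (rule add_mono)
    have "circle_mean r U = 4 * C * R / (R\<^sup>2 - r\<^sup>2) * circle_mean R l"
      unfolding U_def by (rule circle_mean_poisson_kernel_swap(3)[OF r0(1) r(3) lc])
    also have "\<dots> \<le> 4 * C / (R - r) * T"
    proof (rule mult_mono)
      have "R\<^sup>2 - r\<^sup>2 = (R - r) * (R + r)" by (simp add: power2_eq_square algebra_simps)
      moreover have "4 * C / (R - r) * (R / (R + r)) \<le> 4 * C / (R - r) * 1"
        using r r0 C by (intro mult_left_mono) auto
      ultimately show "4 * C * R / (R\<^sup>2 - r\<^sup>2) \<le> 4 * C / (R - r)" by simp
      have "circle_mean R l \<le> 2 * characteristic R f + \<bar>ln (cmod (zor_poly f 0 0))\<bar>"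
        unfolding l_def by (rule characteristic_bounds(1)[OF gen(1) r0(3)])
      also have "\<dots> \<le> T"
        unfolding T_def using characteristic_mono[OF gen(1) r0(2) gen(2) r(4)] by simp
      finally show "circle_mean R l \<le> T" .
      show "0 \<le> circle_mean R l" by (intro circle_mean_nonneg) (simp add: l_def)
      show "0 \<le> 4 * C / (R - r)" using C r by simp
    qed
    finally show "circle_mean r U \<le> 4 * C / (R - r) * T" .
    have "(\<Sum>a\<in>zeros R. circle_mean r (V a)) \<le> (\<Sum>a\<in>zeros R. n a * (128 * C * ln r / r))"
      by (rule sum_mono[OF Vle])
    also have "\<dots> = 128 * C * ln r / r * (\<Sum>a\<in>zeros R. n a)"
      unfolding sum_distrib_right[symmetric] by (rule mult.commute)
    also have "\<dots> \<le> 128 * C * ln r / r * (R' / (R' - R) * T)"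
      unfolding n_def T_def using C r by (intro mult_left_mono count_zeros_le gen) auto
    finally show "(\<Sum>a\<in>zeros R. circle_mean r (V a)) \<le> 128 * C * ln r / r * (R' / (R' - R)) * T"
      by (simp only: mult.assoc)
  qed
  also have "\<dots> = (4 * C / (R - r) + 128 * C * ln r / r * (R' / (R' - R))) * T"
    by (simp only: distrib_right)
  finally show ?thesis by (simp only: T_def)
qed

end

section \<open>Exceptional sets\<close>

lemma nn_integral_inverse_le:
  assumes "0 < a" "a \<le> b"
  shows "(\<integral>\<^sup>+t\<in>{a..<b}. ennreal (1 / t) \<partial>lebesgue) \<le> ennreal (ln (b / a))"
proof -
  have "(\<integral>\<^sup>+t\<in>{a..<b}. ennreal (1 / t) \<partial>lebesgue) \<le> (\<integral>\<^sup>+t. ennreal (1 / t) * indicator {a..b} t \<partial>lebesgue)"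
    by (intro nn_integral_mono) (auto simp: indicator_def)
  also have "\<dots> = (\<integral>\<^sup>+t. ennreal (1 / t) * indicator {a..b} t \<partial>lborel)"
    by (rule nn_integral_completion)
  also have "\<dots> = ennreal (ln b - ln a)"
  proof (rule nn_integral_FTC_Icc)
    fix t assume "t \<in> {a..b}"
    then have "0 < t" using assms by simp
    then show "(ln has_real_derivative 1 / t) (at t)"
      by (auto intro!: derivative_eq_intros)
    show "0 \<le> 1 / t" using \<open>0 < t\<close> by simp
  qed (use assms in auto)
  finally show ?thesis using assms by (simp add: ln_div)
qed

text \<open>The countable \<open>Z\<close> is a null set. Keeping the bound as a series of extended
  nonnegative reals serves finite sums and convergent series alike.\<close>

lemma nn_integral_grid_le:
  fixes x :: "nat \<Rightarrow> real"
  assumes x: "\<And>k. 0 < x k" "\<And>k. x k \<le> x (Suc k)" and Z: "countable Z"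
    and E: "E \<subseteq> (\<Union>k\<in>K. {x k..<x (Suc k)}) \<union> Z"
  shows "(\<integral>\<^sup>+t\<in>E. ennreal (1 / t) \<partial>lebesgue) \<le> (\<Sum>k. ennreal (if k \<in> K then ln (x (Suc k) / x k) else 0))"
proof -
  define u where "u k t = (if k \<in> K then ennreal (1 / t) * indicator {x k..<x (Suc k)} t else 0)" for k t
  have "AE t in lborel. t \<notin> Z"
    using countable_imp_null_set_lborel[OF Z] by (rule AE_not_in)
  then have "AE t in lebesgue. t \<notin> Z" by (rule AE_completion)
  then have "(\<integral>\<^sup>+t\<in>E. ennreal (1 / t) \<partial>lebesgue) \<le> (\<integral>\<^sup>+t. (\<Sum>k. u k t) \<partial>lebesgue)"
  proof (intro nn_integral_mono_AE, eventually_elim)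
    fix t assume "t \<notin> Z"
    show "ennreal (1 / t) * indicator E t \<le> (\<Sum>k. u k t)"
    proof (cases "t \<in> E")
      case True
      then obtain k where k: "k \<in> K" "t \<in> {x k..<x (Suc k)}" using E \<open>t \<notin> Z\<close> by auto
      then have "ennreal (1 / t) * indicator E t = sum (\<lambda>k. u k t) {k}"
        using True by (simp add: u_def)
      also have "\<dots> \<le> (\<Sum>k. u k t)"
        by (rule sum_le_suminf) (auto intro: summableI)
      finally show ?thesis .
    qed simp
  qed
  also have "\<dots> = (\<Sum>k. \<integral>\<^sup>+t. u k t \<partial>lebesgue)"
  proof (rule nn_integral_suminf)
    have "u k \<in> borel_measurable lborel" for k unfolding u_def by measurable
    then show "u k \<in> borel_measurable lebesgue" for k by (rule measurable_completion)
  qed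
  also have "\<dots> \<le> (\<Sum>k. ennreal (if k \<in> K then ln (x (Suc k) / x k) else 0))"
    by (intro suminf_le summableI) (auto simp: u_def intro!: nn_integral_inverse_le x)
  finally show ?thesis .
qed

text \<open>Windows of three cells overlap, so each increment is counted up to three times; only
  three terms survive at either end.\<close>

lemma sum_telescope_3:
  fixes g :: "nat \<Rightarrow> real"
  assumes "m \<le> n"
  shows "(\<Sum>k\<in>{m..<n}. g (k + 3) - g k) = (g n + g (n + 1) + g (n + 2)) - (g m + g (m + 1) + g (m + 2))"
  using assms by (induction n rule: dec_induct) (auto simp: numeral_eq_Suc)

text \<open>Summation by parts turns the increments of \<open>g\<close> into \<open>\<Sum> g k / k\<^sup>2\<close>.\<close>

lemma summable_increments_over_index:
  fixes g :: "nat \<Rightarrow> real"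
  assumes mono: "\<And>k. g k \<le> g (Suc k)" and le: "\<And>k. g k \<le> D * real (Suc k) powr \<gamma>"
    and D: "0 \<le> D" and \<gamma>: "\<gamma> < 1"
  shows "summable (\<lambda>k. (g (Suc k) - g k) / real (Suc k))"
proof (rule bounded_imp_summable)
  define w where "w k = 1 / real (Suc k)" for k
  have sm: "summable (\<lambda>k. real (k + 2) powr (\<gamma> - 2))"
    using \<gamma> by (subst summable_iff_shift) (simp add: summable_real_powr_iff)
  define S where "S = (\<Sum>k. real (k + 2) powr (\<gamma> - 2))"
  show "0 \<le> (g (Suc k) - g k) / real (Suc k)" for k using mono[of k] by simp
  fix n
  have parts: "(\<Sum>k<n. (g (Suc k) - g k) * w k) = g n * w n - g 0 + (\<Sum>k<n. g (Suc k) * (w k - w (Suc k)))" for n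
  proof (induction n)
    case 0
    then show ?case by (simp add: w_def)
  next
    case (Suc n)
    then show ?case by (simp add: algebra_simps)
  qed
  have gn: "g n * w n \<le> D" for n
  proof -
    have "g n \<le> D * real (Suc n) powr 1"
    proof -
      have "real (Suc n) powr \<gamma> \<le> real (Suc n) powr 1" using \<gamma> by (intro powr_mono) auto
      then show ?thesis using le[of n] D by (meson mult_left_mono order_trans)
    qed
    then show ?thesis by (simp add: w_def field_simps)
  qed
  \<comment> \<open>The difference of the weights is 1 / ((k + 1) (k + 2)), and k + 1 >= (k + 2) /
    2. The resulting exponent \<gamma> - 2 is below -1.\<close>
  have summand: "g (Suc k) * (w k - w (Suc k)) \<le> 2 * D * real (k + 2) powr (\<gamma> - 2)" for k
  proof -
    have ww: "w k - w (Suc k) = 1 / (real (k + 1) * real (k + 2))" by (simp add: w_def field_simps)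
    have "1 / (real (k + 1) * real (k + 2)) \<le> 1 / (real (k + 2) / 2 * real (k + 2))"
      by (intro divide_left_mono mult_right_mono) auto
    also have "\<dots> = 2 / (real (k + 2) * real (k + 2))" by simp
    finally have w2: "w k - w (Suc k) \<le> 2 * real (k + 2) powr (-2)"
      unfolding ww by (simp add: powr_minus powr_numeral power2_eq_square divide_inverse del: of_nat_add)
    have "g (Suc k) * (w k - w (Suc k)) \<le> (D * real (k + 2) powr \<gamma>) * (w k - w (Suc k))"
      using le[of "Suc k"] ww by (intro mult_right_mono) auto
    also have "\<dots> \<le> (D * real (k + 2) powr \<gamma>) * (2 * real (k + 2) powr (-2))"
      using D w2 by (intro mult_left_mono) auto
    also have "\<dots> = 2 * D * real (k + 2) powr (\<gamma> - 2)"
      by (simp add: powr_add[of _ \<gamma> "-2", simplified])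
    finally show ?thesis .
  qed
  have "(\<Sum>k<Suc n. (g (Suc k) - g k) * w k) \<le> D - g 0 + (\<Sum>k<Suc n. 2 * D * real (k + 2) powr (\<gamma> - 2))"
    unfolding parts using gn[of "Suc n"] sum_mono[of "{..<Suc n}" _ "\<lambda>k. 2 * D * real (k + 2) powr (\<gamma> - 2)", OF summand] by linarith
  also have "(\<Sum>k<Suc n. 2 * D * real (k + 2) powr (\<gamma> - 2)) \<le> 2 * D * S"
    unfolding sum_distrib_left[symmetric] S_def using D sm by (intro mult_left_mono sum_le_suminf) auto
  finally show "(\<Sum>k\<le>n. (g (Suc k) - g k) / real (Suc k)) \<le> D - g 0 + 2 * D * S"
    by (simp add: w_def lessThan_Suc_atMost)
qed

section \<open>The exceptional set and the estimate outside it\<close>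

context nonconstant_meromorphic
begin

text \<open>Each index rules out only countably many factors, so an interval contains a factor good
  for all of them.\<close>

lemma generic_multiple:
  assumes "\<And>k::nat. 0 < y k"
  obtains \<tau> where "1 < \<tau>" "\<tau> < 2" "\<And>k. generic (\<tau> * y k)"
proof -
  define B where "B = (\<Union>k. (\<lambda>r. r / y k) ` {r. \<not> generic r})"
  have "countable B"
    unfolding B_def by (rule countable_UN[OF countableI_type]) (intro countable_image countable_not_generic)
  then have "\<not> {1<..<2} \<subseteq> B"
    using uncountable_open_interval[of 1 2] countable_subset by auto
  then obtain \<tau> where "\<tau> \<in> {1<..<2}" "\<tau> \<notin> B" by blast
  then have \<tau>: "1 < \<tau>" "\<tau> < 2" "\<tau> \<notin> B" by auto
  have "generic (\<tau> * y k)" for k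
  proof (rule ccontr)
    assume "\<not> generic (\<tau> * y k)"
    moreover have "\<tau> = \<tau> * y k / y k" using assms[of k] by simp
    ultimately show False using \<tau>(3) unfolding B_def by blast
  qed
  then show ?thesis using that \<tau> by blast
qed

text \<open>Three steps: one for the cell that contains r, one between r and \<open>R\<close>, one
  between \<open>R\<close> and \<open>R'\<close>.\<close>

definition bad :: "(nat \<Rightarrow> real) \<Rightarrow> real \<Rightarrow> nat \<Rightarrow> bool" where
  "bad x A k \<longleftrightarrow> A * characteristic (x k) f < characteristic (x (k + 3)) f"

text \<open>Cells below \<open>k0\<close> are left out, because the growth bounds and the positivity
  of the characteristic hold only from there on.\<close>

definition exceptional_set :: "(nat \<Rightarrow> real) \<Rightarrow> real \<Rightarrow> nat \<Rightarrow> real set" where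
  "exceptional_set x A k0 =
     (\<Union>k\<in>{k. k0 \<le> k \<and> bad x A k}. {x k..<x (Suc k)}) \<union> {r. 0 < r \<and> \<not> generic r}"

lemma exceptional_set_lebesgue: "exceptional_set x A k0 \<in> sets lebesgue"
proof -
  have "countable {r. 0 < r \<and> \<not> generic r}"
    by (rule countable_subset[OF _ countable_not_generic]) auto
  then have "exceptional_set x A k0 \<in> sets borel"
    unfolding exceptional_set_def by (intro sets.Un sets.countable_UN') (auto intro: sets.countable)
  then show ?thesis by simp
qed

lemma exceptional_set_pos: "(\<And>k. 0 < x k) \<Longrightarrow> exceptional_set x A k0 \<subseteq> {0<..}"
  unfolding exceptional_set_def by (force intro: less_le_trans)

lemma outside_exceptional_set:
  assumes r: "r \<notin> exceptional_set x A k0" "x k0 \<le> r" and x: "strict_mono x" "filterlim x at_top sequentially"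
    and pos: "0 < x k0"
  obtains k where "k0 \<le> k" "x k \<le> r" "r < x (Suc k)" "characteristic (x (k + 3)) f \<le> A * characteristic (x k) f"
    "generic r"
proof -
  have "eventually (\<lambda>k. r < x k) sequentially"
    using x(2) by (simp add: filterlim_at_top_dense)
  then obtain j where j: "r < x j" by (auto simp: eventually_sequentially)
  define n where "n = (LEAST j. r < x j)"
  have n: "r < x n" unfolding n_def using j by (rule LeastI)
  have "k0 < n" using n r(2) x(1) by (metis leD linorder_not_less order_trans strict_mono_less_eq)
  then obtain k where k: "n = Suc k" "k0 \<le> k" by (cases n) auto
  have "\<not> r < x k" using not_less_Least[of k "\<lambda>j. r < x j"] k by (auto simp: n_def)
  then have xk: "x k \<le> r" by simp
  then show ?thesis
    using that[of k] k n r pos by (auto simp: exceptional_set_def bad_def not_less)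
qed

lemma bad_increment:
  assumes T: "0 < characteristic (x k) f" and A: "0 < A" and bad: "bad x A k"
  shows "ln A < ln (characteristic (x (k + 3)) f) - ln (characteristic (x k) f)"
proof -
  have "A * characteristic (x k) f < characteristic (x (k + 3)) f" using bad by (simp add: bad_def)
  then have "ln (A * characteristic (x k) f) < ln (characteristic (x (k + 3)) f)"
    using T A by (subst ln_less_cancel_iff) (auto intro: less_trans[OF mult_pos_pos])
  then show ?thesis using T A by (simp add: ln_mult)
qed

text \<open>The number \<open>h\<close> bounds both gaps from below. With
  \<open>R' \<le> B * r\<close> the factor R' / (R' - R) is at most B r / h, which turns ln r / r
  into ln r / h. The grid point \<open>s\<close> below r links the characteristic at
  \<open>R'\<close> to that at r by monotonicity.\<close>

lemma shift_estimate:
  fixes c :: complex and A B :: real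
  assumes A: "0 \<le> A" and B: "0 \<le> B"
  obtains K r\<^sub>1 where "0 \<le> K" "3 \<le> r\<^sub>1"
    "\<And>r R R' s h. \<lbrakk>generic r; generic s; generic R; generic R'; r\<^sub>1 \<le> s; s \<le> r; r < R; R < R'; R' \<le> B * r;
        2 * cmod c \<le> h; h \<le> R - r; h \<le> R' - R; 0 < h; characteristic R' f \<le> A * characteristic s f\<rbrakk> \<Longrightarrow>
        proximity r (\<lambda>z. f (z + c) / f z) \<le> K * (ln r / h * characteristic r f)"
proof -
  obtain r0 \<delta> where r0: "1 \<le> r0" "0 < \<delta>" "\<And>s. generic s \<Longrightarrow> r0 \<le> s \<Longrightarrow> \<delta> \<le> characteristic s f"
    using characteristic_pos by blast
  define C where "C = max 1 (cmod c)"
  define k where "k = \<bar>ln (cmod (zor_poly f 0 0))\<bar>"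
  define K where "K = (4 * C + 128 * C * B) * (2 * A + k / \<delta>)"
  have C: "1 \<le> C" "cmod c \<le> C" by (auto simp: C_def)
  show ?thesis
  proof
    show "0 \<le> K" unfolding K_def using C A B r0 by (auto simp: k_def)
    show "3 \<le> max 3 r0" by simp
    fix r R R' s h
    assume gen: "generic r" "generic s" "generic R" "generic R'"
      and s: "max 3 r0 \<le> s" "s \<le> r" and R: "r < R" "R < R'" "R' \<le> B * r"
      and h: "2 * cmod c \<le> h" "h \<le> R - r" "h \<le> R' - R" "0 < h"
      and T: "characteristic R' f \<le> A * characteristic s f"
    have r3: "r \<ge> 3" using s by simp
    have lr: "ln r \<ge> 1" using exp_le r3 by (subst ln_ge_iff) auto
    have Tr: "\<delta> \<le> characteristic r f" using r0(3)[of r] gen s by simp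
    have "characteristic s f \<le> characteristic r f"
      using characteristic_mono[of s r] gen s by (cases "s = r") auto
    then have TA: "characteristic R' f \<le> A * characteristic r f"
      using T A by (meson mult_left_mono order_trans)
    have TR0: "0 \<le> characteristic R' f" using characteristic_nonneg[of R'] gen r3 R by simp
    \<comment> \<open>The additive constant of the first main theorem is absorbed using the lower
      bound \<delta> on the characteristic.\<close>
    have "k = k / \<delta> * \<delta>" using r0 by simp
    also have "\<dots> \<le> k / \<delta> * characteristic r f" using r0 Tr by (intro mult_left_mono) (auto simp: k_def)
    finally have 1: "2 * characteristic R' f + k \<le> (2 * A + k / \<delta>) * characteristic r f"
      using TA by (simp add: distrib_right)
    have 2: "4 * C / (R - r) \<le> 4 * C * ln r / h"
    proof -
      have "4 * C / (R - r) \<le> 4 * C / h" using C h by (intro divide_left_mono) auto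
      also have "\<dots> \<le> 4 * C * ln r / h" using C h lr by (intro divide_right_mono) auto
      finally show ?thesis .
    qed
    have 3: "128 * C * ln r / r * (R' / (R' - R)) \<le> 128 * C * B * ln r / h"
    proof -
      have "R' / (R' - R) \<le> B * r / h" using R h r3 by (intro frac_le) auto
      then have "128 * C * ln r / r * (R' / (R' - R)) \<le> 128 * C * ln r / r * (B * r / h)"
        using C lr r3 by (intro mult_left_mono) auto
      then show ?thesis using r3 by (simp add: mult_ac)
    qed
    have "proximity r (\<lambda>z. f (z + c) / f z) \<le>
        (4 * C / (R - r) + 128 * C * ln r / r * (R' / (R' - R))) * (2 * characteristic R' f + k)"
      unfolding k_def using C r3 h R gen by (intro proximity_shift_quotient_le) auto
    also have "\<dots> \<le> ((4 * C + 128 * C * B) * ln r / h) * ((2 * A + k / \<delta>) * characteristic r f)"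
    proof (rule mult_mono)
      show "4 * C / (R - r) + 128 * C * ln r / r * (R' / (R' - R)) \<le> (4 * C + 128 * C * B) * ln r / h"
        using 2 3 by (simp add: distrib_right add_divide_distrib)
      show "0 \<le> (4 * C + 128 * C * B) * ln r / h" using C B lr h by simp
      show "0 \<le> 2 * characteristic R' f + k" using TR0 by (simp add: k_def)
    qed (rule 1)
    also have "\<dots> = K * (ln r / h * characteristic r f)" by (simp add: K_def)
    finally show "proximity r (\<lambda>z. f (z + c) / f z) \<le> K * (ln r / h * characteristic r f)" .
  qed
qed

end

section \<open>Growth bounds from order and hyper-order\<close>

lemma log_plus_nonneg [simp]: "0 \<le> log_plus x"
  by (simp add: log_plus_def)

lemma ln_le_log_plus: "0 < x \<Longrightarrow> ln x \<le> log_plus x"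
  by (simp add: log_plus_def)

lemma proximity_nonneg: "0 \<le> proximity r f"
proof -
  have "proximity r f = circle_mean r (\<lambda>z. log_plus (cmod (f z)))"
    by (simp add: proximity_def circle_mean_def)
  also have "\<dots> \<ge> 0" by (rule circle_mean_nonneg) simp
  finally show ?thesis .
qed

lemma finite_growth_order_bound:
  assumes "growth_order f < \<infinity>"
  obtains \<rho> X where "0 < \<rho>" "1 < X" "\<And>r. X \<le> r \<Longrightarrow> log_plus (characteristic r f) \<le> \<rho> * ln r"
proof -
  obtain \<rho> where \<rho>: "growth_order f < ereal \<rho>"
    using ereal_dense2[OF assms] by auto
  have "eventually (\<lambda>r. log_plus (characteristic r f) / ln r < \<rho>) at_top"
    using Limsup_lessD[OF \<rho>[unfolded growth_order_def]] by simp
  then obtain X where X: "\<And>r. X \<le> r \<Longrightarrow> log_plus (characteristic r f) / ln r < \<rho>"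
    by (auto simp: eventually_at_top_linorder)
  show ?thesis
  proof
    show "0 < max \<rho> 1" "1 < max X 2" by auto
    fix r assume r: "max X 2 \<le> r"
    then have ln: "ln r > 0" by simp
    have "log_plus (characteristic r f) \<le> \<rho> * ln r"
      using X[of r] r ln by (simp add: field_simps)
    also have "\<dots> \<le> max \<rho> 1 * ln r" using ln by (intro mult_right_mono) auto
    finally show "log_plus (characteristic r f) \<le> max \<rho> 1 * ln r" .
  qed
qed

lemma hyper_order_bound:
  assumes "hyper_order f < ereal \<beta>"
  obtains X where "1 < X" "\<And>r. X \<le> r \<Longrightarrow> log_plus (characteristic r f) \<le> r powr \<beta>"
proof -
  have "eventually (\<lambda>r. log_plus (log_plus (characteristic r f)) / ln r < \<beta>) at_top"
    using Limsup_lessD[OF assms[unfolded hyper_order_def]] by simp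
  then obtain X where X: "\<And>r. X \<le> r \<Longrightarrow> log_plus (log_plus (characteristic r f)) / ln r < \<beta>"
    by (auto simp: eventually_at_top_linorder)
  show ?thesis
  proof
    show "1 < max X 2" by auto
    fix r assume r: "max X 2 \<le> r"
    then have ln: "ln r > 0" by simp
    define y where "y = log_plus (characteristic r f)"
    have "log_plus y \<le> \<beta> * ln r"
      using X[of r] r ln by (simp add: y_def field_simps)
    then have "ln y \<le> ln (r powr \<beta>)" if "y > 0"
      using ln_le_log_plus[OF that] r by (simp add: ln_powr)
    moreover have "r powr \<beta> > 0" using r by simp
    ultimately show "y \<le> r powr \<beta>"
      by (cases "y > 0") (auto simp only: not_less ln_le_cancel_iff intro: order_trans[of y 0])
  qed
qed

text \<open>This makes the grid exponent 1 / \<beta> meaningful, as \<beta> is chosen above the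
  hyper-order.\<close>

lemma hyper_order_nonneg: "0 \<le> hyper_order f"
  unfolding hyper_order_def
proof (rule le_Limsup)
  show "\<forall>\<^sub>F r in at_top. 0 \<le> ereal (log_plus (log_plus (characteristic r f)) / ln r)"
    using eventually_ge_at_top[of 1] by eventually_elim simp
qed simp

section \<open>The two cases: finite order, and hyper-order below 1\<close>

context nonconstant_meromorphic
begin

text \<open>Every bad cell raises ln T over its window by more than \<open>l\<close>, whereas the
  whole rise up to r is about \<rho> ln r and is counted at most three times. So about 3 \<rho> ln r
  / l bad cells meet [1, r).\<close>

lemma shift_quotient_finite_order:
  assumes order: "growth_order f < \<infinity>" and \<epsilon>: "\<epsilon> > 0"
  shows "\<exists>E. E \<in> sets lebesgue \<and> E \<subseteq> {0<..} \<and> upper_log_density E \<le> ereal \<epsilon> \<and>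
     (\<forall>c::complex. (\<lambda>r. proximity r (\<lambda>z. f (z + c) / f z))
        \<in> O[at_top_outside E](\<lambda>r. ln r / r * characteristic r f))"
proof -
  obtain \<rho> X where \<rho>: "0 < \<rho>" and X: "1 < X" "\<And>r. X \<le> r \<Longrightarrow> log_plus (characteristic r f) \<le> \<rho> * ln r"
    using finite_growth_order_bound[OF order] by blast
  obtain r0 \<delta> where r0: "1 \<le> r0" "0 < \<delta>" "\<And>s. generic s \<Longrightarrow> r0 \<le> s \<Longrightarrow> \<delta> \<le> characteristic s f"
    using characteristic_pos by blast
  obtain \<tau> where \<tau>: "1 < \<tau>" "\<tau> < 2" "\<And>k::nat. generic (\<tau> * 2 ^ k)"
    using generic_multiple[of "\<lambda>k. 2 ^ k"] by auto
  define x where "x k = \<tau> * 2 ^ k" for k :: nat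
  have xpos: "0 < x k" for k using \<tau> by (simp add: x_def)
  have xS: "x (Suc k) = 2 * x k" for k by (simp add: x_def)
  have xmono: "strict_mono x" using xpos by (simp add: strict_mono_Suc_iff xS)
  have xle: "x k \<le> x (Suc k)" for k using xpos[of k] by (simp add: xS)
  have xtop: "filterlim x at_top sequentially"
    unfolding x_def using \<tau> by real_asymp
  have gen: "generic (x k)" for k using \<tau> by (simp add: x_def)
  have "eventually (\<lambda>k. max X r0 \<le> x k) sequentially"
    using xtop unfolding filterlim_at_top by blast
  then obtain k0 where k0: "\<And>k. k0 \<le> k \<Longrightarrow> X \<le> x k \<and> r0 \<le> x k"
    by (auto simp: eventually_sequentially)
  \<comment> \<open>Large enough for 3 \<rho> / l < \<epsilon>.\<close>
  define l where "l = 6 * \<rho> / \<epsilon> + 1"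
  define A where "A = exp l"
  have l: "l > 0" using \<rho> \<epsilon> by (simp add: l_def add_pos_pos)
  define E where "E = exceptional_set x A k0"
  define g where "g k = ln (characteristic (x k) f)" for k
  have Tpos: "0 < characteristic (x k) f" if "k0 \<le> k" for k
    using r0(3)[OF gen[of k]] k0[OF that] r0(2) by linarith
  have gmono: "g k \<le> g m" if "k0 \<le> k" "k \<le> m" for k m
    using Tpos[OF that(1)] characteristic_mono[OF gen[of k] xpos gen[of m]] that xmono
    by (cases "k = m") (auto simp: g_def strict_mono_less)
  have gle: "g k \<le> \<rho> * ln (x k)" if "k0 \<le> k" for k
    using ln_le_log_plus[OF Tpos[OF that]] X(2)[of "x k"] k0[OF that] by (simp add: g_def)
  have density: "(LINT t:E \<inter> {1..<r}|lebesgue. 1 / t) \<le> 3 / l * (\<rho> * ln (16 * r) - g k0)" if r: "x k0 \<le> r" for r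
  proof -
    have r1: "r > 1" using r k0[of k0] X by linarith
    \<comment> \<open>Cells of index \<open>M\<close> or more start beyond r, while 2^M <= 2r keeps
      ln T at \<open>x (M + 2)\<close> under control.\<close>
    define M where "M = nat \<lceil>log 2 r\<rceil>"
    have "0 \<le> log 2 r" using r1 by simp
    then have M: "log 2 r \<le> real M" "real M \<le> log 2 r + 1" unfolding M_def by linarith+
    have M1: "r \<le> 2 ^ M"
      using M(1) r1 by (simp add: log_le_iff powr_realpow)
    have "2 powr real M \<le> 2 powr (log 2 r + 1)" using M(2) by (intro powr_mono) auto
    then have M2: "2 ^ M \<le> 2 * r" using r1 by (simp add: powr_add powr_realpow)
    have kM: "k < M" if "x k < r" for k
    proof (rule ccontr)
      assume "\<not> k < M"
      then have "(2::real) ^ M \<le> 2 ^ k" by (intro power_increasing) auto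
      also have "\<dots> \<le> x k" using \<tau> by (simp add: x_def)
      finally show False using M1 that by simp
    qed
    have "k0 < M"
    proof -
      have "2 ^ k0 < x k0" using \<tau> by (simp add: x_def)
      then have "(2::real) ^ k0 < 2 ^ M" using r M1 by linarith
      then show ?thesis by simp
    qed
    define K where "K = {k. k0 \<le> k \<and> k < M \<and> bad x A k}"
    define a where "a k = (if k \<in> K then ln (x (Suc k) / x k) else 0)" for k
    have a: "a k = (if k \<in> K then ln 2 else 0)" for k using xpos[of k] by (simp add: a_def xS)
    have a0: "0 \<le> a k" for k by (simp add: a)
    have "(\<integral>\<^sup>+t\<in>E \<inter> {1..<r}. ennreal (1 / t) \<partial>lebesgue) \<le> (\<Sum>k. ennreal (a k))"
      unfolding a_def
    proof (rule nn_integral_grid_le[where x = x, OF xpos xle countable_not_generic])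
      show "E \<inter> {1..<r} \<subseteq> (\<Union>k\<in>K. {x k..<x (Suc k)}) \<union> {r. \<not> generic r}"
        unfolding E_def exceptional_set_def K_def using kM by fastforce
    qed
    also have "\<dots> = (\<Sum>k\<in>{k0..<M}. ennreal (a k))"
      by (rule suminf_finite) (auto simp: a K_def)
    also have "\<dots> = ennreal (\<Sum>k\<in>{k0..<M}. a k)"
      using a0 by (intro sum_ennreal) auto
    \<comment> \<open>A bad cell has measure ln 2 < 1 and is paid for by its increment, which
      exceeds \<open>l\<close>; at other cells the increment is still nonnegative.\<close>
    also have "(\<Sum>k\<in>{k0..<M}. a k) \<le> (\<Sum>k\<in>{k0..<M}. (g (k + 3) - g k) / l)"
    proof (rule sum_mono)
      fix k assume k: "k \<in> {k0..<M}"
      show "a k \<le> (g (k + 3) - g k) / l"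
      proof (cases "k \<in> K")
        case True
        then have "l < g (k + 3) - g k"
          using bad_increment[of x k A] Tpos[of k] k by (simp add: K_def g_def A_def)
        then have "1 \<le> (g (k + 3) - g k) / l" using l by simp
        then show ?thesis using True ln_2_less_1 by (simp add: a)
      next
        case False
        then show ?thesis using gmono[of k "k + 3"] k l by (simp add: a)
      qed
    qed
    also have "\<dots> = ((g M + g (M + 1) + g (M + 2)) - (g k0 + g (k0 + 1) + g (k0 + 2))) / l"
      unfolding sum_divide_distrib[symmetric] using \<open>k0 < M\<close> by (subst sum_telescope_3) auto
    also have "\<dots> \<le> (3 * g (M + 2) - 3 * g k0) / l"
      using gmono[of M "M + 2"] gmono[of "M + 1" "M + 2"] gmono[of k0 "k0 + 1"] gmono[of k0 "k0 + 2"] \<open>k0 < M\<close> l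
      by (intro divide_right_mono) auto
    also have "\<dots> \<le> (3 * (\<rho> * ln (16 * r)) - 3 * g k0) / l"
    proof -
      \<comment> \<open>The constant 16 is the product of 4 from two further cells, 2 from \<tau>
        and 2 from the rounding in \<open>M\<close>.\<close>
      have "\<tau> * 2 ^ M \<le> 2 * (2 * r)" using M2 \<tau> by (intro mult_mono) auto
      then have "x (M + 2) \<le> 16 * r" by (simp add: x_def)
      then have "ln (x (M + 2)) \<le> ln (16 * r)" using xpos[of "M + 2"] r1 by (intro ln_mono) auto
      then have "\<rho> * ln (x (M + 2)) \<le> \<rho> * ln (16 * r)" using \<rho> by simp
      then have "g (M + 2) \<le> \<rho> * ln (16 * r)" using gle[of "M + 2"] \<open>k0 < M\<close> by simp
      then show ?thesis using l by (intro divide_right_mono) auto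
    qed
    also have "\<dots> = 3 / l * (\<rho> * ln (16 * r) - g k0)" by (simp add: right_diff_distrib diff_divide_distrib)
    finally have nn: "(\<integral>\<^sup>+t\<in>E \<inter> {1..<r}. ennreal (1 / t) \<partial>lebesgue) \<le> ennreal (3 / l * (\<rho> * ln (16 * r) - g k0))"
      by (simp add: ennreal_leI)
    have "0 \<le> \<rho> * ln (16 * r) - g k0"
    proof -
      have "g k0 \<le> \<rho> * ln (x k0)" by (rule gle) simp
      also have "\<dots> \<le> \<rho> * ln (16 * r)" using \<rho> r xpos[of k0] r1 by (intro mult_left_mono ln_mono) auto
      finally show ?thesis by simp
    qed
    then have nonneg: "0 \<le> 3 / l * (\<rho> * ln (16 * r) - g k0)" using l by simp
    have "(\<integral>\<^sup>+t. ennreal (indicat_real (E \<inter> {1..<r}) t *\<^sub>R (1 / t)) \<partial>lebesgue) =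
          (\<integral>\<^sup>+t\<in>E \<inter> {1..<r}. ennreal (1 / t) \<partial>lebesgue)"
      by (intro nn_integral_cong) (simp add: indicator_def)
    then show ?thesis
      unfolding set_lebesgue_integral_def using nn nonneg by (intro integral_real_bounded) auto
  qed
  have "upper_log_density E \<le> ereal \<epsilon>"
    unfolding upper_log_density_def
  proof (rule Limsup_bounded)
    have "((\<lambda>r. 3 / l * (\<rho> * ln (16 * r) - g k0) / ln r) \<longlongrightarrow> 3 / l * \<rho>) at_top"
      using l \<rho> by real_asymp
    moreover have "3 / l * \<rho> < \<epsilon>"
    proof -
      have "3 * \<rho> < \<epsilon> * l" using \<rho> \<epsilon> by (simp add: l_def distrib_left)
      then show ?thesis using l by (simp add: field_simps)
    qed
    ultimately have "eventually (\<lambda>r. 3 / l * (\<rho> * ln (16 * r) - g k0) / ln r < \<epsilon>) at_top"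
      by (rule order_tendstoD)
    then show "\<forall>\<^sub>F r in at_top. ereal ((LINT t:E \<inter> {1..<r}|lebesgue. 1 / t) / ln r) \<le> ereal \<epsilon>"
      using eventually_ge_at_top[of "x k0"] eventually_gt_at_top[of 1]
    proof eventually_elim
      case (elim r)
      have "(LINT t:E \<inter> {1..<r}|lebesgue. 1 / t) / ln r \<le> 3 / l * (\<rho> * ln (16 * r) - g k0) / ln r"
        using density[OF elim(2)] elim(3) by (intro divide_right_mono) auto
      then show ?case using elim(1) by simp
    qed
  qed
  moreover have "(\<lambda>r. proximity r (\<lambda>z. f (z + c) / f z)) \<in> O[at_top_outside E](\<lambda>r. ln r / r * characteristic r f)"
    for c :: complex
  proof -
    obtain K r1 where K: "0 \<le> K" "3 \<le> r1"
      "\<And>r R R' s h. \<lbrakk>generic r; generic s; generic R; generic R'; r1 \<le> s; s \<le> r; r < R; R < R'; R' \<le> 8 * r;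
        2 * cmod c \<le> h; h \<le> R - r; h \<le> R' - R; 0 < h; characteristic R' f \<le> A * characteristic s f\<rbrakk> \<Longrightarrow>
        proximity r (\<lambda>z. f (z + c) / f z) \<le> K * (ln r / h * characteristic r f)"
      using shift_estimate[of A 8 c] by (auto simp: A_def)
    have "eventually (\<lambda>r. r \<in> - E \<longrightarrow> norm (proximity r (\<lambda>z. f (z + c) / f z)) \<le> K * norm (ln r / r * characteristic r f)) at_top"
      using eventually_ge_at_top[of "max (x k0) (max (2 * r1) (2 * cmod c))"]
    proof (eventually_elim, intro impI)
      fix r assume r: "max (x k0) (max (2 * r1) (2 * cmod c)) \<le> r" and "r \<in> - E"
      then obtain k where k: "k0 \<le> k" "x k \<le> r" "r < x (Suc k)" "characteristic (x (k + 3)) f \<le> A * characteristic (x k) f"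
        "generic r"
        using outside_exceptional_set[of r x A k0] xmono xtop xpos unfolding E_def by auto
      have xk: "x (k + 2) = 4 * x k" "x (k + 3) = 8 * x k" by (simp_all add: x_def power_add)
      \<comment> \<open>Here h = r: from \<open>r < 2 * x k\<close> both gaps, 4 x_k - r and 4 x_k,
        exceed r, and r >= 2 r1 gives \<open>r1 \<le> x k\<close>.\<close>
      have "proximity r (\<lambda>z. f (z + c) / f z) \<le> K * (ln r / r * characteristic r f)"
        by (rule K(3)[of r "x k" "x (k + 2)" "x (k + 3)"])
           (use k gen[of k] gen[of "k + 2"] gen[of "k + 3"] r xk xS[of k] xpos[of k] K(2) in auto)
      also have "\<dots> \<le> K * norm (ln r / r * characteristic r f)"
        using K(1) by (intro mult_left_mono) (simp_all only: real_norm_def abs_ge_self)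
      finally show "norm (proximity r (\<lambda>z. f (z + c) / f z)) \<le> K * norm (ln r / r * characteristic r f)"
        using proximity_nonneg by simp
    qed
    then show ?thesis
      by (intro bigoI[of _ K]) (simp add: at_top_outside_def eventually_inf_principal)
  qed
  ultimately show ?thesis
    using exceptional_set_lebesgue[of x A k0] exceptional_set_pos[of x A k0, OF xpos] unfolding E_def by blast
qed

text \<open>Between \<sigma> and \<sigma> + \<epsilon> two exponents are inserted: \<alpha> bounds
  the growth of ln T, and \<beta> > \<alpha> fixes the grid, whose spacing at r is of order r^(1 -
  \<beta>).\<close>

lemma shift_quotient_hyper_order:
  assumes order: "hyper_order f = ereal \<sigma>" "\<sigma> < 1" and \<epsilon>: "\<epsilon> > 0"
  shows "\<exists>E. E \<in> sets lebesgue \<and> E \<subseteq> {0<..} \<and> finite_log_measure E \<and>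
     (\<lambda>r. proximity r (\<lambda>z. f (z + c) / f z))
        \<in> o[at_top_outside E](\<lambda>r. characteristic r f / r powr (1 - \<sigma> - \<epsilon>))"
proof -
  have \<sigma>: "0 \<le> \<sigma>" using hyper_order_nonneg[of f] order by simp
  \<comment> \<open>The quarter keeps \<beta> = \<sigma> + 2e strictly below both 1 and \<sigma> +
    \<epsilon>.\<close>
  define e where "e = min \<epsilon> (1 - \<sigma>) / 4"
  define \<alpha> where "\<alpha> = \<sigma> + e"
  define \<beta> where "\<beta> = \<sigma> + 2 * e"
  define p where "p = 1 / \<beta>"
  \<comment> \<open>The growth exponent of ln T along the grid, equal to \<alpha> / \<beta> <
    1.\<close>
  define \<gamma> where "\<gamma> = p * \<alpha>"
  have e: "0 < e" "4 * e \<le> \<epsilon>" "4 * e \<le> 1 - \<sigma>" using \<epsilon> order by (auto simp: e_def)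
  have \<alpha>: "0 < \<alpha>" "\<alpha> < \<beta>" and \<beta>: "0 < \<beta>" "\<beta> < 1" "\<beta> < \<sigma> + \<epsilon>"
    using e \<sigma> by (auto simp: \<alpha>_def \<beta>_def)
  have p: "1 < p" "p * \<beta> = 1" using \<beta> by (auto simp: p_def)
  have \<gamma>: "0 < \<gamma>" "\<gamma> < 1" using \<alpha> \<beta> by (auto simp: \<gamma>_def p_def)
  have "hyper_order f < ereal \<alpha>" using order e by (simp add: \<alpha>_def)
  then obtain X where X: "1 < X" "\<And>r. X \<le> r \<Longrightarrow> log_plus (characteristic r f) \<le> r powr \<alpha>"
    using hyper_order_bound by blast
  obtain r0 \<delta> where r0: "1 \<le> r0" "0 < \<delta>" "\<And>s. generic s \<Longrightarrow> r0 \<le> s \<Longrightarrow> \<delta> \<le> characteristic s f"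
    using characteristic_pos by blast
  obtain \<tau> where \<tau>: "1 < \<tau>" "\<tau> < 2" "\<And>k::nat. generic (\<tau> * real (Suc k) powr p)"
    using generic_multiple[of "\<lambda>k. real (Suc k) powr p"] by auto
  define x where "x k = \<tau> * real (Suc k) powr p" for k :: nat
  have xpos: "0 < x k" for k using \<tau> by (simp add: x_def)
  \<comment> \<open>Splitting one factor off each p-th power replaces the mean value theorem, at the
    cost of the factor p.\<close>
  have step: "\<tau> * real (Suc k) powr (p - 1) \<le> x (Suc k) - x k" for k
  proof -
    have P: "real (Suc m) powr p = real (Suc m) powr (p - 1) * real (Suc m)" for m
      using powr_add[of "real (Suc m)" "p - 1" 1] by simp
    have "real (Suc k) powr (p - 1) * real (Suc (Suc k)) \<le> real (Suc (Suc k)) powr p"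
      unfolding P[of "Suc k"] using p by (intro mult_right_mono powr_mono2) auto
    then have "real (Suc k) powr (p - 1) \<le> real (Suc (Suc k)) powr p - real (Suc k) powr p"
      unfolding P[of k] by (simp add: algebra_simps)
    then have "\<tau> * real (Suc k) powr (p - 1) \<le> \<tau> * (real (Suc (Suc k)) powr p - real (Suc k) powr p)"
      using \<tau> by (intro mult_left_mono) auto
    then show ?thesis by (simp add: x_def right_diff_distrib)
  qed
  have xlt: "x k < x (Suc k)" for k
  proof -
    have "0 < \<tau> * real (Suc k) powr (p - 1)" using \<tau> by simp
    then show ?thesis using step[of k] by linarith
  qed
  have xmono: "strict_mono x" using xlt by (simp add: strict_mono_Suc_iff)
  have xtop: "filterlim x at_top sequentially"
    unfolding x_def using \<tau> p by real_asymp
  have gen: "generic (x k)" for k using \<tau> by (simp add: x_def)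
  have "eventually (\<lambda>k. max X r0 \<le> x k) sequentially"
    using xtop unfolding filterlim_at_top by blast
  then obtain k0 where k0: "\<And>k. k0 \<le> k \<Longrightarrow> X \<le> x k \<and> r0 \<le> x k"
    by (auto simp: eventually_sequentially)
  \<comment> \<open>With A = e a bad window raises ln T by more than 1.\<close>
  define A :: real where "A = exp 1"
  define E where "E = exceptional_set x A k0"
  \<comment> \<open>Frozen below \<open>k0\<close>, so that monotonicity and the growth bound hold
    for every index.\<close>
  define g where "g k = ln (characteristic (x (max k k0)) f)" for k
  have Tpos: "0 < characteristic (x k) f" if "k0 \<le> k" for k
    using r0(3)[OF gen[of k]] k0[OF that] r0(2) by linarith
  have gmono: "g k \<le> g (Suc k)" for k
    using Tpos[of "max k k0"] characteristic_mono[OF gen[of k] xpos gen[of "Suc k"] xlt]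
    by (auto simp: g_def max_def not_less_eq_eq le_Suc_eq)
  \<comment> \<open>The 2 bounds \<tau>^\<alpha>; the other factor comes from max k k0 + 1 <= (k0 +
    1) (k + 1).\<close>
  define D where "D = 2 * real (Suc k0) powr \<gamma>"
  have gle: "g k \<le> D * real (Suc k) powr \<gamma>" for k
  proof -
    define m where "m = max k k0"
    have "g k \<le> x m powr \<alpha>"
      using ln_le_log_plus[OF Tpos[of m]] X(2)[of "x m"] k0[of m] by (simp add: g_def m_def)
    also have "\<dots> = \<tau> powr \<alpha> * real (Suc m) powr \<gamma>"
      using \<tau> by (simp add: x_def powr_mult powr_powr \<gamma>_def)
    also have "\<dots> \<le> 2 * (real (Suc k0) * real (Suc k)) powr \<gamma>"
    proof (intro mult_mono powr_mono2)
      have "\<tau> powr \<alpha> \<le> \<tau> powr 1" using \<tau> \<alpha> \<beta> by (intro powr_mono) auto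
      then show "\<tau> powr \<alpha> \<le> 2" using \<tau> by simp
      have "Suc m \<le> Suc k0 * Suc k" by (simp add: m_def)
      then show "real (Suc m) \<le> real (Suc k0) * real (Suc k)" by (metis of_nat_le_iff of_nat_mult)
    qed (use \<gamma> in auto)
    also have "\<dots> = D * real (Suc k) powr \<gamma>" by (simp add: D_def powr_mult)
    finally show ?thesis .
  qed
  define d where "d k = (g (Suc k) - g k) / real (Suc k)" for k
  have d0: "0 \<le> d k" for k using gmono[of k] by (simp add: d_def)
  have sd: "summable d"
    unfolding d_def by (rule summable_increments_over_index[OF gmono gle _ \<gamma>(2)]) (simp add: D_def)
  define a where "a k = (if k \<in> {k. k0 \<le> k \<and> bad x A k} then ln (x (Suc k) / x k) else 0)" for k
  have a0: "0 \<le> a k" for k using xpos[of k] xlt[of k] by (simp add: a_def)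
  have ratio: "x (k + j) \<le> real (Suc j) powr p * x k" for k j
  proof -
    have "real (Suc (k + j)) \<le> real (Suc j) * real (Suc k)" by (simp add: algebra_simps)
    then have "real (Suc (k + j)) powr p \<le> real (Suc j) powr p * real (Suc k) powr p"
      using p powr_mono2[of p "real (Suc (k + j))" "real (Suc j) * real (Suc k)"] by (simp add: powr_mult)
    then show ?thesis using \<tau> by (simp add: x_def mult_left_mono mult.left_commute)
  qed
  \<comment> \<open>For a bad cell the three increments of \<open>g\<close> add up to more than 1.
    Dividing by 3 (k + 1), which bounds each of the indices k + 1, k + 2, k + 3, compares 1 / (k +
    1) with the summable \<open>d\<close>; the measure of the cell is at most p / (k + 1).\<close>
  have ale: "a k \<le> 3 * p * (d k + d (k + 1) + d (k + 2))" for k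
  proof (cases "k0 \<le> k \<and> bad x A k")
    case True
    have "1 < ln (characteristic (x (k + 3)) f) - ln (characteristic (x k) f)"
      using bad_increment[of x k A] Tpos[of k] True by (simp add: A_def)
    also have "\<dots> = g (k + 3) - g k" using True by (simp add: g_def max_absorb1)
    also have "\<dots> = d k * real (k + 1) + d (k + 1) * real (k + 2) + d (k + 2) * real (k + 3)"
      by (simp add: d_def numeral_eq_Suc)
    also have "\<dots> \<le> d k * (3 * real (k + 1)) + d (k + 1) * (3 * real (k + 1)) + d (k + 2) * (3 * real (k + 1))"
      using d0 by (intro add_mono mult_left_mono) auto
    finally have 1: "1 / real (k + 1) \<le> 3 * (d k + d (k + 1) + d (k + 2))"
      by (simp add: field_simps)
    have "x (Suc k) / x k = (1 + 1 / real (k + 1)) powr p"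
    proof -
      have "1 + 1 / real (k + 1) = real (Suc (Suc k)) / real (Suc k)" by (simp add: field_simps)
      then show ?thesis using \<tau> by (simp add: x_def powr_divide)
    qed
    then have "ln (x (Suc k) / x k) = p * ln (1 + 1 / real (k + 1))"
      by (simp add: ln_powr add_pos_nonneg)
    also have "\<dots> \<le> p * (1 / real (k + 1))"
      using p by (intro mult_left_mono ln_add_one_self_le_self) auto
    also have "\<dots> \<le> p * (3 * (d k + d (k + 1) + d (k + 2)))"
      using 1 p by (intro mult_left_mono) auto
    also have "\<dots> = 3 * p * (d k + d (k + 1) + d (k + 2))" by simp
    finally show ?thesis using True by (simp only: a_def mem_Collect_eq simp_thms if_True)
  next
    case False
    then show ?thesis using d0 p by (auto simp: a_def intro!: mult_nonneg_nonneg add_nonneg_nonneg)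
  qed
  have sa: "summable a"
  proof (rule summable_comparison_test'[where N = 0])
    show "summable (\<lambda>k. 3 * p * (d k + d (k + 1) + d (k + 2)))"
      using sd summable_ignore_initial_segment[OF sd, of 1] summable_ignore_initial_segment[OF sd, of 2]
      by (intro summable_mult summable_add)
  qed (use ale a0 in auto)
  have "finite_log_measure E"
  proof -
    have "(\<integral>\<^sup>+t\<in>E \<inter> {1..}. ennreal (1 / t) \<partial>lebesgue) \<le> (\<Sum>k. ennreal (a k))"
      unfolding a_def
    proof (rule nn_integral_grid_le[where x = x, OF xpos less_imp_le[OF xlt] countable_not_generic])
      show "E \<inter> {1..} \<subseteq> (\<Union>k\<in>{k. k0 \<le> k \<and> bad x A k}. {x k..<x (Suc k)}) \<union> {r. \<not> generic r}"
        unfolding E_def exceptional_set_def by auto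
    qed
    also have "\<dots> < \<infinity>" using suminf_ennreal2[OF a0 sa] by simp
    finally show ?thesis by (simp add: finite_log_measure_def)
  qed
  moreover have "(\<lambda>r. proximity r (\<lambda>z. f (z + c) / f z)) \<in> o[at_top_outside E](\<lambda>r. characteristic r f / r powr (1 - \<sigma> - \<epsilon>))"
  proof -
    obtain K r1 where K: "0 \<le> K" "3 \<le> r1"
      "\<And>r R R' s h. \<lbrakk>generic r; generic s; generic R; generic R'; r1 \<le> s; s \<le> r; r < R; R < R'; R' \<le> 4 powr p * r;
        2 * cmod c \<le> h; h \<le> R - r; h \<le> R' - R; 0 < h; characteristic R' f \<le> A * characteristic s f\<rbrakk> \<Longrightarrow>
        proximity r (\<lambda>z. f (z + c) / f z) \<le> K * (ln r / h * characteristic r f)"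
      using shift_estimate[of A "4 powr p" c] by (auto simp: A_def)
    have main: "proximity r (\<lambda>z. f (z + c) / f z) \<le> K * (ln r / r powr (1 - \<beta>) * characteristic r f)"
      if r: "x k0 \<le> r" "2 powr p * r1 \<le> r" "2 * cmod c \<le> r powr (1 - \<beta>)" and rE: "r \<notin> E" for r
    proof -
      obtain k where k: "k0 \<le> k" "x k \<le> r" "r < x (Suc k)" "characteristic (x (k + 3)) f \<le> A * characteristic (x k) f"
        "generic r"
        using outside_exceptional_set[of r x A k0] xmono xtop xpos r rE unfolding E_def by auto
      have "r powr (1 - \<beta>) \<le> x (Suc k) powr (1 - \<beta>)"
        using k xpos[of k] \<beta> by (intro powr_mono2) auto
      \<comment> \<open>Since p \<beta> = 1, the exponent p (1 - \<beta>) is p - 1, the same as in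
        \<open>step\<close>: r^(1 - \<beta>) is at most the length of the next cell.\<close>
      also have "\<dots> = \<tau> powr (1 - \<beta>) * real (Suc (Suc k)) powr (p - 1)"
        using \<tau> p by (simp add: x_def powr_mult powr_powr right_diff_distrib)
      also have "\<dots> \<le> \<tau> * real (Suc (Suc k)) powr (p - 1)"
        using \<tau> \<beta> powr_mono[of "1 - \<beta>" 1 \<tau>] by (intro mult_right_mono) auto
      finally have h: "r powr (1 - \<beta>) \<le> \<tau> * real (Suc (Suc k)) powr (p - 1)" .
      have R1: "r powr (1 - \<beta>) \<le> x (k + 2) - r"
        using h step[of "Suc k"] k(3) by (simp add: numeral_eq_Suc)
      have "\<tau> * real (Suc (Suc k)) powr (p - 1) \<le> \<tau> * real (Suc (Suc (Suc k))) powr (p - 1)"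
        using \<tau> p by (intro mult_left_mono powr_mono2) auto
      then have R2: "r powr (1 - \<beta>) \<le> x (k + 3) - x (k + 2)"
        using h step[of "Suc (Suc k)"] by (simp add: numeral_eq_Suc)
      have rpos: "r > 0" using k(2) xpos[of k] by linarith
      have "x (Suc k) \<le> 2 powr p * x k" using ratio[of k 1] by simp
      then have "2 powr p * r1 < 2 powr p * x k" using k(3) r(2) by linarith
      then have s: "r1 \<le> x k" by simp
      have "x (k + 3) \<le> 4 powr p * x k" using ratio[of k 3] by simp
      also have "\<dots> \<le> 4 powr p * r" using k(2) by simp
      finally have R3: "x (k + 3) \<le> 4 powr p * r" .
      have hpos: "0 < r powr (1 - \<beta>)" using rpos by simp
      have R4: "r < x (k + 2)" "x (k + 2) < x (k + 3)" using R1 R2 hpos by linarith+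
      show ?thesis
        by (rule K(3)[OF k(5) gen gen gen s k(2) R4 R3 r(3) R1 R2 hpos k(4)])
    qed
    \<comment> \<open>The spare exponent between \<beta> and \<sigma> + \<epsilon>, which absorbs ln
      r and the constant \<open>K\<close> and turns O into o.\<close>
    define \<eta> where "\<eta> = \<sigma> + \<epsilon> - \<beta>"
    have \<eta>: "\<eta> > 0" using \<beta> by (simp add: \<eta>_def)
    show ?thesis
    proof (rule landau_o.smallI)
      fix b :: real assume b: "b > 0"
      have "((\<lambda>r. K * (ln r / r powr \<eta>)) \<longlongrightarrow> 0) at_top"
        using \<eta> by real_asymp
      then have ev1: "eventually (\<lambda>r. K * (ln r / r powr \<eta>) < b) at_top"
        using b by (rule order_tendstoD)
      have "filterlim (\<lambda>r. r powr (1 - \<beta>)) at_top at_top"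
        using \<beta> by real_asymp
      then have ev2: "eventually (\<lambda>r. 2 * cmod c \<le> r powr (1 - \<beta>)) at_top"
        by (simp add: filterlim_at_top)
      have "eventually (\<lambda>r. r \<in> - E \<longrightarrow> norm (proximity r (\<lambda>z. f (z + c) / f z)) \<le>
              b * norm (characteristic r f / r powr (1 - \<sigma> - \<epsilon>))) at_top"
        using ev1 ev2 eventually_ge_at_top[of "max (x k0) (2 powr p * r1)"] eventually_gt_at_top[of 1]
      proof (eventually_elim, intro impI)
        fix r assume r: "K * (ln r / r powr \<eta>) < b" "2 * cmod c \<le> r powr (1 - \<beta>)"
          "max (x k0) (2 powr p * r1) \<le> r" "1 < r" "r \<in> - E"
        have "proximity r (\<lambda>z. f (z + c) / f z) \<le> K * (ln r / r powr (1 - \<beta>) * characteristic r f)"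
          using r by (intro main) auto
        also have "\<dots> \<le> K * (ln r / r powr (1 - \<beta>) * \<bar>characteristic r f\<bar>)"
          using K(1) r by (intro mult_left_mono) auto
        also have "r powr (1 - \<beta>) = r powr \<eta> * r powr (1 - \<sigma> - \<epsilon>)"
          by (simp add: \<eta>_def flip: powr_add)
        also have "K * (ln r / (r powr \<eta> * r powr (1 - \<sigma> - \<epsilon>)) * \<bar>characteristic r f\<bar>) =
            K * (ln r / r powr \<eta>) * (\<bar>characteristic r f\<bar> / r powr (1 - \<sigma> - \<epsilon>))"
          by simp
        also have "\<dots> \<le> b * (\<bar>characteristic r f\<bar> / r powr (1 - \<sigma> - \<epsilon>))"
          using r(1) by (intro mult_right_mono) auto
        finally show "norm (proximity r (\<lambda>z. f (z + c) / f z)) \<le> b * norm (characteristic r f / r powr (1 - \<sigma> - \<epsilon>))"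
          using proximity_nonneg by simp
      qed
      then show "eventually (\<lambda>r. norm (proximity r (\<lambda>z. f (z + c) / f z)) \<le>
              b * norm (characteristic r f / r powr (1 - \<sigma> - \<epsilon>))) (at_top_outside E)"
        by (simp add: at_top_outside_def eventually_inf_principal)
    qed
  qed
  ultimately show ?thesis
    using exceptional_set_lebesgue[of x A k0] exceptional_set_pos[of x A k0, OF xpos] unfolding E_def by blast
qed

end

theorem theorem5p1:
  fixes f :: "complex \<Rightarrow> complex" and \<epsilon> :: real
  assumes "f nicely_meromorphic_on UNIV"
    and "\<not> f constant_on UNIV"
    and "\<epsilon> > 0"
  shows "(growth_order f < \<infinity> \<longrightarrow>
           (\<exists>E. E \<in> sets lebesgue \<and> E \<subseteq> {0<..} \<and> upper_log_density E \<le> ereal \<epsilon> \<and>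
             (\<forall>c::complex.
               (\<lambda>r. proximity r (\<lambda>z. f (z + c) / f z))
                 \<in> O[at_top_outside E](\<lambda>r. ln r / r * characteristic r f))))
       \<and> (\<forall>(c::complex) (\<sigma>::real). hyper_order f = ereal \<sigma> \<and> \<sigma> < 1 \<longrightarrow>
           (\<exists>E. E \<in> sets lebesgue \<and> E \<subseteq> {0<..} \<and> finite_log_measure E \<and>
             (\<lambda>r. proximity r (\<lambda>z. f (z + c) / f z))
               \<in> o[at_top_outside E](\<lambda>r. characteristic r f / r powr (1 - \<sigma> - \<epsilon>))))"
proof -
  interpret nonconstant_meromorphic f
    using assms by unfold_locales
  show ?thesis
    using shift_quotient_finite_order[OF _ assms(3)] shift_quotient_hyper_order[OF _ _ assms(3)] by blast
qed

end
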